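(* Let $\mathcal{A}\subseteq\mathcal{B}(\mathcal{H}_1)$ and $\mathcal{B}\subseteq\mathcal{B}(\mathcal{H}_2)$ be reflexive algebras. Let $\mathcal{U}\subseteq\mathcal{B}(\mathcal{H}_1,\mathcal{H}_2)$ be a normalizing ultraweakly closed subspace and let $\chi=\operatorname{Map}\mathcal{U}$ and $\chi^*=\operatorname{Map}\mathcal{U}^*$. Then $\mathcal{U}\subseteq N(\mathcal{B},\mathcal{A})$ if and only if (i) $\chi(L)\perp\chi(L^\perp)$ for each $L\in\operatorname{Lat}\mathcal{A}$, while $\chi^*(M)\perp\chi^*(M^\perp)$ for each $M\in\operatorname{Lat}\mathcal{B}$; and (ii) $\chi_o(\operatorname{Lat}\mathcal{A}_o)=\operatorname{Lat}\mathcal{B}_o$.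
   Context: All Hilbert spaces are complex and separable; $P^\perp=I-P$ for a projection $P$. For a set $\mathcal{X}$ of operators on a Hilbert space, $\operatorname{Lat}\mathcal{X}$ is the lattice of projections $L$ with $L^\perp XL=0$ for all $X\in\mathcal{X}$. Reflexive algebras are unital algebras $\mathcal{A}$ with $\mathcal{A}=\{A:L^\perp AL=0\ \forall L\in\operatorname{Lat}\mathcal{A}\}$. $N(\mathcal{B},\mathcal{A})=\{T\in\mathcal{B}(\mathcal{H}_1,\mathcal{H}_2):T^*\mathcal{B}T\subseteq\mathcal{A}\text{ and }T\mathcal{A}T^*\subseteq\mathcal{B}\}$. A linear subspace $\mathcal{U}$ is normalizing if $AB^*C\in\mathcal{U}$ for all $A,B,C\in\mathcal{U}$. The map $\operatorname{Map}\mathcal{U}$ of a subspace sends a projection $P$ on the domain space to the projection onto the closed linear span of $\{Sx:S\in\mathcal{U},x\in\operatorname{ran}P\}$; $\mathcal{U}^*=\{T^*:T\in\mathcal{U}\}$. Let $\mathcal{K}_1$ be the closed linear span of $\mathcal{U}^*(\mathcal{H}_2)$ (equivalently $0_+^\perp\mathcal{H}_1$ where $0_+=\bigvee\{P:\chi(P)=0\}$) and $\mathcal{K}_2$ the closed linear span of $\mathcal{U}(\mathcal{H}_1)$ (the range of $\chi(I)$). $\mathcal{A}_o$ (resp. $\mathcal{B}_o$) denotes the compression of $\mathcal{A}$ to $\mathcal{K}_1$ (resp. of $\mathcal{B}$ to $\mathcal{K}_2$), $\mathcal{U}_o\subseteq\mathcal{B}(\mathcal{K}_1,\mathcal{K}_2)$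 the restriction of $\mathcal{U}$ to $\mathcal{K}_1$, and $\chi_o=\operatorname{Map}\mathcal{U}_o$. *)

theory Defs
  imports "HOL-Analysis.Analysis"
begin

text \<open>
  Complex separable Hilbert spaces. The norm, the topology and completeness come from the
  underlying real Hilbert space; the real inner product is the real part of the complex one, so that
  the norm of \<open>x\<close> is the square root of \<open>\<langle>x | x\<rangle>\<close>. The complex inner product is linear in its first
  argument.
\<close>

class separable_chilbert = banach + real_inner +
  fixes scaleC :: "complex \<Rightarrow> 'a \<Rightarrow> 'a" (infixr \<open>*\<^sub>C\<close> 75)
    and cinner :: "'a \<Rightarrow> 'a \<Rightarrow> complex" (\<open>\<langle>_ | _\<rangle>\<close>)
  assumes scaleC_add_right: "a *\<^sub>C (x + y) = a *\<^sub>C x + a *\<^sub>C y"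
    and scaleC_add_left: "(a + b) *\<^sub>C x = a *\<^sub>C x + b *\<^sub>C x"
    and scaleC_scaleC: "a *\<^sub>C b *\<^sub>C x = (a * b) *\<^sub>C x"
    and scaleC_of_real: "complex_of_real r *\<^sub>C x = r *\<^sub>R x"
    and cinner_commute: "\<langle>x | y\<rangle> = cnj \<langle>y | x\<rangle>"
    and cinner_add_left: "\<langle>x + y | z\<rangle> = \<langle>x | z\<rangle> + \<langle>y | z\<rangle>"
    and cinner_scaleC_left: "\<langle>a *\<^sub>C x | y\<rangle> = a * \<langle>x | y\<rangle>"
    and Re_cinner: "Re \<langle>x | y\<rangle> = x \<bullet> y"
    and separable: "\<exists>D. countable D \<and> (\<forall>x. \<forall>e>0. \<exists>d\<in>D. dist d x < e)"

global_interpretation complex_vector: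
  vector_space "scaleC :: complex \<Rightarrow> 'a \<Rightarrow> 'a::separable_chilbert"
proof
  fix x :: 'a
  show "1 *\<^sub>C x = x"
    using scaleC_of_real[of 1 x] by simp
qed (rule scaleC_add_right scaleC_add_left scaleC_scaleC)+

definition closed_span :: "'a::separable_chilbert set \<Rightarrow> 'a set" where
  "closed_span X = closure (complex_vector.span X)"

text \<open>
  The argument sets \<open>K\<close>, \<open>K1\<close>, \<open>K2\<close> below stand for closed linear subspaces of the ambient types,
  regarded as Hilbert spaces in their own right; the ambient spaces themselves are the case \<open>UNIV\<close>.
  An operator defined on \<open>K\<close> is a function that takes the value \<open>undefined\<close> outside \<open>K\<close>, so that
  equality of functions is equality of operators.
\<close>

definition bounded_ops ::
    "'a::separable_chilbert set \<Rightarrow> 'b::separable_chilbert set \<Rightarrow> ('a \<Rightarrow> 'b) set" where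
  "bounded_ops K1 K2 = {T \<in> K1 \<rightarrow>\<^sub>E K2.
     (\<forall>x\<in>K1. \<forall>y\<in>K1. T (x + y) = T x + T y) \<and>
     (\<forall>c. \<forall>x\<in>K1. T (c *\<^sub>C x) = c *\<^sub>C T x) \<and>
     (\<exists>M. \<forall>x\<in>K1. norm (T x) \<le> M * norm x)}"

definition projections :: "'a::separable_chilbert set \<Rightarrow> ('a \<Rightarrow> 'a) set" where
  "projections K = {P \<in> bounded_ops K K.
     (\<forall>x\<in>K. P (P x) = P x) \<and> (\<forall>x\<in>K. \<forall>y\<in>K. \<langle>P x | y\<rangle> = \<langle>x | P y\<rangle>)}"

definition proj_onto :: "'a::separable_chilbert set \<Rightarrow> 'a set \<Rightarrow> 'a \<Rightarrow> 'a" where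
  "proj_onto K M = (THE P. P \<in> projections K \<and> P ` K = M)"

definition proj_compl :: "'a::separable_chilbert set \<Rightarrow> ('a \<Rightarrow> 'a) \<Rightarrow> 'a \<Rightarrow> 'a" where
  "proj_compl K P = (\<lambda>x\<in>K. x - P x)"

definition proj_orthogonal ::
    "'a::separable_chilbert set \<Rightarrow> ('a \<Rightarrow> 'a) \<Rightarrow> ('a \<Rightarrow> 'a) \<Rightarrow> bool" where
  "proj_orthogonal K P Q \<longleftrightarrow> (\<forall>x\<in>K. P (Q x) = 0)"

definition Lat :: "'a::separable_chilbert set \<Rightarrow> ('a \<Rightarrow> 'a) set \<Rightarrow> ('a \<Rightarrow> 'a) set" where
  "Lat K \<X> = {L \<in> projections K. \<forall>X\<in>\<X>. \<forall>x\<in>K. proj_compl K L (X (L x)) = 0}"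

definition Map ::
    "'a::separable_chilbert set \<Rightarrow> 'b::separable_chilbert set \<Rightarrow> ('a \<Rightarrow> 'b) set \<Rightarrow> ('a \<Rightarrow> 'a) \<Rightarrow> 'b \<Rightarrow> 'b"
  where
  "Map K1 K2 \<U> P = proj_onto K2 (closed_span {S x | S x. S \<in> \<U> \<and> x \<in> P ` K1})"

definition compression :: "'a::separable_chilbert set \<Rightarrow> ('a \<Rightarrow> 'a) set \<Rightarrow> ('a \<Rightarrow> 'a) set" where
  "compression K \<A> = (\<lambda>A. \<lambda>x\<in>K. proj_onto UNIV K (A x)) ` \<A>"

definition restriction :: "'a::separable_chilbert set \<Rightarrow> ('a \<Rightarrow> 'b::separable_chilbert) set \<Rightarrow> ('a \<Rightarrow> 'b) set"
  where
  "restriction K \<U> = (\<lambda>T. restrict T K) ` \<U>"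

definition cadjoint ::
    "('a::separable_chilbert \<Rightarrow> 'b::separable_chilbert) \<Rightarrow> 'b \<Rightarrow> 'a" where
  "cadjoint T = (THE S. S \<in> bounded_ops UNIV UNIV \<and> (\<forall>x y. \<langle>T x | y\<rangle> = \<langle>x | S y\<rangle>))"

definition adjoints ::
    "('a::separable_chilbert \<Rightarrow> 'b::separable_chilbert) set \<Rightarrow> ('b \<Rightarrow> 'a) set" where
  "adjoints \<U> = cadjoint ` \<U>"

definition operator_subspace ::
    "('a::separable_chilbert \<Rightarrow> 'b::separable_chilbert) set \<Rightarrow> bool" where
  "operator_subspace \<U> \<longleftrightarrow>
     \<U> \<subseteq> bounded_ops UNIV UNIV \<and>
     (\<lambda>x. 0) \<in> \<U> \<and>
     (\<forall>S\<in>\<U>. \<forall>T\<in>\<U>. (\<lambda>x. S x + T x) \<in> \<U>) \<and>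
     (\<forall>c. \<forall>T\<in>\<U>. (\<lambda>x. c *\<^sub>C T x) \<in> \<U>)"

definition normalizing ::
    "('a::separable_chilbert \<Rightarrow> 'b::separable_chilbert) set \<Rightarrow> bool" where
  "normalizing \<U> \<longleftrightarrow> (\<forall>A\<in>\<U>. \<forall>B\<in>\<U>. \<forall>C\<in>\<U>. A \<circ> cadjoint B \<circ> C \<in> \<U>)"

definition unital_algebra :: "('a::separable_chilbert \<Rightarrow> 'a) set \<Rightarrow> bool" where
  "unital_algebra \<A> \<longleftrightarrow>
     operator_subspace \<A> \<and> id \<in> \<A> \<and> (\<forall>A\<in>\<A>. \<forall>B\<in>\<A>. A \<circ> B \<in> \<A>)"

definition reflexive_algebra :: "('a::separable_chilbert \<Rightarrow> 'a) set \<Rightarrow> bool" where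
  "reflexive_algebra \<A> \<longleftrightarrow>
     unital_algebra \<A> \<and>
     \<A> = {A \<in> bounded_ops UNIV UNIV. \<forall>L\<in>Lat UNIV \<A>. \<forall>x. proj_compl UNIV L (A (L x)) = 0}"

definition normalizer ::
    "('b::separable_chilbert \<Rightarrow> 'b) set \<Rightarrow> ('a::separable_chilbert \<Rightarrow> 'a) set \<Rightarrow> ('a \<Rightarrow> 'b) set" where
  "normalizer \<B> \<A> = {T \<in> bounded_ops UNIV UNIV.
     (\<forall>B\<in>\<B>. cadjoint T \<circ> B \<circ> T \<in> \<A>) \<and> (\<forall>A\<in>\<A>. T \<circ> A \<circ> cadjoint T \<in> \<B>)}"

text \<open>
  The ultraweak (\<open>\<sigma>\<close>-weak) topology on the bounded operators is the coarsest one that makes all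
  functionals \<open>T \<mapsto> (\<Sum>n. \<langle>T (x n) | y n\<rangle>)\<close> with square-summable \<open>x\<close> and \<open>y\<close> continuous.
\<close>

definition ultraweak_topology ::
    "('a::separable_chilbert \<Rightarrow> 'b::separable_chilbert) topology" where
  "ultraweak_topology = topology_generated_by
     {{T \<in> bounded_ops UNIV UNIV. (\<Sum>n. \<langle>T (x n) | y n\<rangle>) \<in> V} | x y V.
        summable (\<lambda>n::nat. (norm (x n))\<^sup>2) \<and> summable (\<lambda>n. (norm (y n))\<^sup>2) \<and> open V}"

end

theory Submission
  imports Defs
begin

text \<open>
  A projection is determined by its range, so the theorem is really about closed subspaces: an element
  of a lattice \<open>Lat\<close> becomes an invariant subspace (\<open>Lat_eq_inv_subspaces\<close>, \<open>Lat_compression\<close>), the map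
  \<open>\<chi>\<close> becomes \<open>V \<mapsto> [\<U> V]\<close>, the closed span of the vectors \<open>S v\<close>, and reflexivity of \<open>\<A>\<close> says that an
  operator which leaves every invariant subspace of \<open>\<A>\<close> invariant belongs to \<open>\<A>\<close>. In this form
  condition (i) states exactly that \<open>\<U>\<^sup>*\<U> \<subseteq> \<A>\<close> and \<open>\<U>\<U>\<^sup>* \<subseteq> \<B>\<close> (\<open>orthogonal_images_iff\<close>), and condition
  (ii) states that \<open>V \<mapsto> [\<U> V]\<close> maps the invariant subspaces of the compression of \<open>\<A>\<close> to \<open>K1\<close> onto those
  of the compression of \<open>\<B>\<close> to \<open>K2\<close> (\<open>Map_restriction_Lat_iff\<close>).

  The tool for everything that follows is nondegeneracy of \<open>\<U>\<U>\<^sup>*\<close> on \<open>K2\<close>: because \<open>\<U>\<U>\<^sup>*\<U> \<subseteq> \<U>\<close>, the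
  component in \<open>K2\<close> of any vector \<open>w\<close> lies in the closed span of the vectors \<open>S T\<^sup>* w\<close> (\<open>nondegenerate\<close>).
  So a closed subspace contains the component of \<open>w\<close> as soon as it contains all \<open>S T\<^sup>* w\<close>. The same
  holds for \<open>\<U>\<^sup>*\<U>\<close> and \<open>K1\<close>, since \<open>\<U>\<^sup>*\<close> is again normalizing.

  If \<open>\<U>\<close> normalizes, then \<open>\<U>\<^sup>*\<B>\<U> \<subseteq> \<A>\<close> and \<open>\<U>\<A>\<U>\<^sup>* \<subseteq> \<B>\<close> by polarization, and (i) follows because the
  algebras are unital. For \<open>V\<close> invariant under the compression of \<open>\<A>\<close>, the inclusion
  \<open>\<U>\<U>\<^sup>*\<B>\<U> V \<subseteq> \<U> V\<close> and nondegeneracy make \<open>[\<U> V]\<close> invariant under the compression of \<open>\<B>\<close>. By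
  symmetry \<open>W \<mapsto> [\<U>\<^sup>* W]\<close> goes the other way, and \<open>[\<U> [\<U>\<^sup>* W]] = W\<close>, again by nondegeneracy; this gives
  (ii).

  Conversely, let \<open>V\<close> be invariant under \<open>\<A>\<close>. By (i) it contains the \<open>K1\<close>-components of its vectors, so
  \<open>V \<inter> K1\<close> is invariant under the compression of \<open>\<A>\<close> and \<open>\<U> V \<subseteq> [\<U> (V \<inter> K1)]\<close>. By (ii) the latter space
  is invariant under the compression of \<open>\<B>\<close>, and \<open>\<U>\<^sup>*\<close> maps it into \<open>V\<close> by (i); hence \<open>T\<^sup>* B T\<close> leaves \<open>V\<close>
  invariant. For \<open>T A T\<^sup>*\<close> and \<open>V\<close> invariant under \<open>\<B>\<close>, surjectivity in (ii) provides \<open>V'\<close> with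
  \<open>V \<inter> K2 = [\<U> V']\<close>, and \<open>V\<close> is carried into \<open>V'\<close>, \<open>V'\<close> and back into \<open>V\<close> by \<open>T\<^sup>*\<close>, by \<open>A\<close> followed by the
  projection onto \<open>K1\<close>, and by \<open>T\<close>.
\<close>

section \<open>Complex inner products\<close>

lemma cinner_add_right: "\<langle>x | y + z\<rangle> = \<langle>x | y\<rangle> + \<langle>x | z :: 'a::separable_chilbert\<rangle>"
  using cinner_add_left[of y z x] by (metis cinner_commute complex_cnj_add)

lemma cinner_scaleC_right: "\<langle>x | a *\<^sub>C y\<rangle> = cnj a * \<langle>x | y :: 'a::separable_chilbert\<rangle>"
  using cinner_scaleC_left[of a y x] by (metis cinner_commute complex_cnj_mult)

lemma cinner_zero_left [simp]: "\<langle>0 | y :: 'a::separable_chilbert\<rangle> = 0"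
  using cinner_add_left[of 0 0 y] by simp

lemma cinner_zero_right [simp]: "\<langle>x | 0 :: 'a::separable_chilbert\<rangle> = 0"
  using cinner_add_right[of x 0 0] by simp

lemma cinner_diff_left: "\<langle>x - y | z\<rangle> = \<langle>x | z\<rangle> - \<langle>y | z :: 'a::separable_chilbert\<rangle>"
  using cinner_add_left[of "x - y" y z] by simp

lemma cinner_diff_right: "\<langle>x | y - z\<rangle> = \<langle>x | y\<rangle> - \<langle>x | z :: 'a::separable_chilbert\<rangle>"
  using cinner_add_right[of x "y - z" z] by simp

lemma cinner_eq_zero_sym: "\<langle>x | y\<rangle> = 0 \<longleftrightarrow> \<langle>y | x :: 'a::separable_chilbert\<rangle> = 0"
  by (metis cinner_commute complex_cnj_zero_iff)

lemma cinner_self_eq_zero: "\<langle>x | x\<rangle> = 0 \<longleftrightarrow> x = (0 :: 'a::separable_chilbert)"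
  by (metis Re_cinner cinner_zero_left inner_eq_zero_iff zero_complex.sel(1))

lemma cinner_ext:
  assumes "\<And>x. \<langle>x | y\<rangle> = \<langle>x | z :: 'a::separable_chilbert\<rangle>"
  shows "y = z"
  using assms[of "y - z"] cinner_self_eq_zero[of "y - z"] by (simp add: cinner_diff_right)

text \<open>
  Continuity of the complex inner product is reduced in this way to that of the real one.
\<close>

lemma cinner_eq_inner:
  "\<langle>x | y\<rangle> = Complex (x \<bullet> y) (- ((\<i> *\<^sub>C x) \<bullet> (y :: 'a::separable_chilbert)))"
proof -
  have "(\<i> *\<^sub>C x) \<bullet> y = Re (\<i> * \<langle>x | y\<rangle>)"
    by (metis Re_cinner cinner_scaleC_left)
  then show ?thesis
    by (simp add: complex_eq_iff Re_cinner)
qed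

lemma continuous_on_cinner_right: "continuous_on UNIV (\<lambda>y :: 'a::separable_chilbert. \<langle>x | y\<rangle>)"
  unfolding cinner_eq_inner by (intro continuous_on_Complex continuous_intros)

section \<open>Closed subspaces and orthogonal projections\<close>

definition closed_subspace :: "'a::separable_chilbert set \<Rightarrow> bool" where
  "closed_subspace V \<longleftrightarrow> complex_vector.subspace V \<and> closed V"

lemma closed_subspaceD:
  assumes "closed_subspace V"
  shows "0 \<in> V" "x \<in> V \<Longrightarrow> y \<in> V \<Longrightarrow> x + y \<in> V" "x \<in> V \<Longrightarrow> c *\<^sub>C x \<in> V"
    "x \<in> V \<Longrightarrow> y \<in> V \<Longrightarrow> x - y \<in> V" "closed V"
  using assms unfolding closed_subspace_def
  by (auto intro: complex_vector.subspace_0 complex_vector.subspace_add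
      complex_vector.subspace_scale complex_vector.subspace_diff)

lemma closed_subspaceI:
  assumes "0 \<in> V" "\<And>x y. x \<in> V \<Longrightarrow> y \<in> V \<Longrightarrow> x + y \<in> V" "\<And>c x. x \<in> V \<Longrightarrow> c *\<^sub>C x \<in> V" "closed V"
  shows "closed_subspace V"
  using assms unfolding closed_subspace_def complex_vector.subspace_def by blast

lemma closed_subspace_UNIV [simp]: "closed_subspace UNIV"
  by (simp add: closed_subspace_def complex_vector.subspace_UNIV)

lemma closed_subspace_Int:
  "closed_subspace V \<Longrightarrow> closed_subspace W \<Longrightarrow> closed_subspace (V \<inter> W)"
  by (simp add: closed_subspace_def complex_vector.subspace_inter closed_Int)

lemma closed_subspace_orthogonal: "closed_subspace {y. \<forall>x\<in>X. \<langle>x | y :: 'a::separable_chilbert\<rangle> = 0}"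
proof (rule closed_subspaceI)
  have "{y. \<forall>x\<in>X. \<langle>x | y\<rangle> = 0} = (\<Inter>x\<in>X. (\<lambda>y. \<langle>x | y\<rangle>) -` {0 :: complex})" by auto
  also have "closed \<dots>"
    by (intro closed_INT ballI closed_vimage closed_singleton continuous_on_cinner_right)
  finally show "closed {y. \<forall>x\<in>X. \<langle>x | y\<rangle> = 0}" .
qed (auto simp: cinner_add_right cinner_scaleC_right)

lemma norm_scaleC: "norm (c *\<^sub>C x) = cmod c * norm (x :: 'a::separable_chilbert)"
proof -
  have *: "complex_of_real ((norm y)\<^sup>2) = \<langle>y | y\<rangle>" for y :: 'a
  proof -
    have "Im \<langle>y | y\<rangle> = 0"
      using cinner_commute[of y y] by (metis Im_divide_of_nat Reals_cnj_iff complex_is_Real_iff)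
    then show ?thesis by (simp add: complex_eq_iff Re_cinner power2_norm_eq_inner)
  qed
  have "complex_of_real ((norm (c *\<^sub>C x))\<^sup>2) = (c * cnj c) * \<langle>x | x\<rangle>"
    unfolding * by (simp add: cinner_scaleC_left cinner_scaleC_right)
  also have "\<dots> = complex_of_real ((cmod c * norm x)\<^sup>2)"
    unfolding *[symmetric] complex_norm_square[symmetric] by (simp add: power_mult_distrib)
  finally have "complex_of_real ((norm (c *\<^sub>C x))\<^sup>2) = complex_of_real ((cmod c * norm x)\<^sup>2)" .
  then show ?thesis
    by (metis norm_ge_zero of_real_eq_iff power2_eq_imp_eq zero_le_mult_iff)
qed

lemma continuous_on_scaleC: "continuous_on UNIV (\<lambda>x :: 'a::separable_chilbert. c *\<^sub>C x)"
proof -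
  have "bounded_linear (\<lambda>x :: 'a. c *\<^sub>C x)"
    by (rule bounded_linear_intro[where K = "cmod c"])
      (simp_all add: scaleC_add_right norm_scaleC mult.commute
        complex_vector.scale_left_commute flip: scaleC_of_real)
  then show ?thesis by (simp add: linear_continuous_on)
qed

lemma closed_subspace_closed_span [simp]:
  "closed_subspace (closed_span (X :: 'a::separable_chilbert set))"
proof (rule closed_subspaceI)
  let ?S = "complex_vector.span X"
  show "0 \<in> closed_span X"
    unfolding closed_span_def using complex_vector.span_zero closure_subset by blast
  show "closed (closed_span X)"
    by (simp add: closed_span_def)
  show "x + y \<in> closed_span X" if xy: "x \<in> closed_span X" "y \<in> closed_span X" for x y
  proof -
    obtain f where "\<forall>n. f n \<in> ?S" "f \<longlonglongrightarrow> x"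
      using xy(1) unfolding closed_span_def closure_sequential by blast
    moreover obtain g where "\<forall>n. g n \<in> ?S" "g \<longlonglongrightarrow> y"
      using xy(2) unfolding closed_span_def closure_sequential by blast
    ultimately have "\<forall>n. f n + g n \<in> ?S" "(\<lambda>n. f n + g n) \<longlonglongrightarrow> x + y"
      by (auto intro: complex_vector.span_add tendsto_add)
    then show ?thesis
      unfolding closed_span_def closure_sequential by (intro exI[of _ "\<lambda>n. f n + g n"]) simp
  qed
  show "c *\<^sub>C x \<in> closed_span X" if x: "x \<in> closed_span X" for c x
  proof -
    obtain f where "\<forall>n. f n \<in> ?S" "f \<longlonglongrightarrow> x"
      using x unfolding closed_span_def closure_sequential by blast
    moreover from this have "(\<lambda>n. c *\<^sub>C f n) \<longlonglongrightarrow> c *\<^sub>C x"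
      using continuous_on_tendsto_compose[OF continuous_on_scaleC] by auto
    ultimately show ?thesis
      unfolding closed_span_def closure_sequential
      by (intro exI[of _ "\<lambda>n. c *\<^sub>C f n"]) (simp add: complex_vector.span_scale)
  qed
qed

lemma closed_span_superset: "X \<subseteq> closed_span X"
  unfolding closed_span_def using complex_vector.span_superset closure_subset by blast

lemma closed_span_minimal: "X \<subseteq> V \<Longrightarrow> closed_subspace V \<Longrightarrow> closed_span X \<subseteq> V"
  unfolding closed_span_def closed_subspace_def
  by (rule closure_minimal[OF complex_vector.span_minimal]) simp_all

lemma orthogonal_closed_span:
  assumes "\<And>x. x \<in> X \<Longrightarrow> \<langle>x | y\<rangle> = 0" and "x \<in> closed_span X"
  shows "\<langle>x | y :: 'a::separable_chilbert\<rangle> = 0"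
proof -
  have "closed_span X \<subseteq> {z. \<forall>w\<in>{y}. \<langle>w | z\<rangle> = 0}"
    using assms(1) cinner_eq_zero_sym
    by (intro closed_span_minimal closed_subspace_orthogonal) auto
  then show ?thesis using assms(2) cinner_eq_zero_sym by auto
qed

text \<open>
  A minimizing sequence is Cauchy by the parallelogram law: the midpoint of two of its members is again
  in \<open>V\<close>, so it is no closer to \<open>x\<close> than the infimum, and this forces the members to be close.
\<close>

lemma best_approximation_exists:
  fixes x :: "'a::separable_chilbert"
  assumes "closed_subspace V"
  obtains v where "v \<in> V" "\<And>w. w \<in> V \<Longrightarrow> norm (x - v) \<le> norm (x - w)"
proof -
  define d where "d = (INF w\<in>V. (norm (x - w))\<^sup>2)"
  have bdd: "bdd_below ((\<lambda>w. (norm (x - w))\<^sup>2) ` V)"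
    by (rule bdd_belowI2[of _ 0]) simp
  have d_le: "d \<le> (norm (x - w))\<^sup>2" if "w \<in> V" for w
    unfolding d_def by (rule cINF_lower[OF bdd that])
  have "\<exists>w\<in>V. (norm (x - w))\<^sup>2 < d + inverse (real (Suc n))" for n
    using cINF_less_iff[OF _ bdd, of "d + inverse (real (Suc n))"] closed_subspaceD(1)[OF assms]
    unfolding d_def by fastforce
  then obtain v where vV: "\<And>n. v n \<in> V"
    and v: "\<And>n. (norm (x - v n))\<^sup>2 < d + inverse (real (Suc n))"
    by metis
  have dist_v: "(norm (v m - v n))\<^sup>2 \<le> 2 * inverse (real (Suc m)) + 2 * inverse (real (Suc n))" for m n
  proof -
    have "(1/2) *\<^sub>R (v m + v n) \<in> V"
      using closed_subspaceD(2,3)[OF assms] vV by (metis scaleC_of_real)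
    then have "d \<le> (norm (x - (1/2) *\<^sub>R (v m + v n)))\<^sup>2" by (rule d_le)
    \<comment> \<open>the parallelogram law for the vectors \<open>x - v m\<close> and \<open>x - v n\<close>\<close>
    moreover have "(norm (v m - v n))\<^sup>2 + 4 * (norm (x - (1/2) *\<^sub>R (v m + v n)))\<^sup>2
        = 2 * (norm (x - v m))\<^sup>2 + 2 * (norm (x - v n))\<^sup>2"
      by (simp add: power2_norm_eq_inner algebra_simps inner_commute)
    ultimately show ?thesis using v[of m] v[of n] by linarith
  qed
  have "Cauchy v"
  proof (rule metric_CauchyI)
    fix e :: real assume "e > 0"
    then obtain N where N: "inverse (real (Suc N)) < e\<^sup>2 / 4"
      using reals_Archimedean[of "e\<^sup>2 / 4"] by auto
    have "dist (v m) (v n) < e" if "m \<ge> N" "n \<ge> N" for m n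
    proof -
      have "inverse (real (Suc k)) \<le> inverse (real (Suc N))" if "k \<ge> N" for k
        using that by (intro le_imp_inverse_le) auto
      from this[OF that(1)] this[OF that(2)] have "(norm (v m - v n))\<^sup>2 < e\<^sup>2"
        using dist_v[of m n] N by linarith
      then show ?thesis
        using \<open>e > 0\<close> by (metis dist_norm less_eq_real_def power2_less_imp_less)
    qed
    then show "\<exists>M. \<forall>m\<ge>M. \<forall>n\<ge>M. dist (v m) (v n) < e" by blast
  qed
  then obtain l where l: "v \<longlonglongrightarrow> l"
    using Cauchy_convergent convergentD by blast
  have "l \<in> V"
    using closed_sequentially[OF closed_subspaceD(5)[OF assms]] vV l by blast
  have "(\<lambda>n. (norm (x - v n))\<^sup>2) \<longlonglongrightarrow> (norm (x - l))\<^sup>2"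
    by (intro tendsto_intros l)
  moreover have "(\<lambda>n. d + inverse (real (Suc n))) \<longlonglongrightarrow> d + 0"
    by (intro tendsto_intros LIMSEQ_inverse_real_of_nat)
  ultimately have "(norm (x - l))\<^sup>2 \<le> d + 0"
    by (rule LIMSEQ_le) (use v less_imp_le in blast)
  then have "norm (x - l) \<le> norm (x - w)" if "w \<in> V" for w
    using d_le[OF that] by (auto intro: power2_le_imp_le[OF order_trans])
  then show thesis using that \<open>l \<in> V\<close> by blast
qed

text \<open>
  If the residual \<open>x - v\<close> of the best approximation were not orthogonal to some \<open>w \<in> V\<close>, then moving \<open>v\<close>
  along \<open>w\<close> would improve it. This gives orthogonality for the real inner product; applying it to \<open>\<i> w\<close> as
  well gives the complex one.
\<close>

lemma orthogonal_decomposition: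
  fixes x :: "'a::separable_chilbert"
  assumes "closed_subspace V"
  obtains v where "v \<in> V" "\<And>w. w \<in> V \<Longrightarrow> \<langle>x - v | w\<rangle> = 0"
proof -
  obtain v where v: "v \<in> V" "\<And>w. w \<in> V \<Longrightarrow> norm (x - v) \<le> norm (x - w)"
    using best_approximation_exists[OF assms] by blast
  have real0: "(x - v) \<bullet> w = 0" if "w \<in> V" for w
  proof (rule ccontr)
    assume neq: "(x - v) \<bullet> w \<noteq> 0"
    then have w0: "w \<bullet> w \<noteq> 0" by auto
    \<comment> \<open>\<open>t\<close> minimizes the distance from \<open>x\<close> to \<open>v + t w\<close>\<close>
    define t where "t = ((x - v) \<bullet> w) / (w \<bullet> w)"
    have "v + t *\<^sub>R w \<in> V"
      using closed_subspaceD(2,3)[OF assms] v(1) that by (metis scaleC_of_real)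
    then have "(norm (x - v))\<^sup>2 \<le> (norm (x - v - t *\<^sub>R w))\<^sup>2"
      using v(2) by (simp add: diff_diff_eq)
    also have "\<dots> = (norm (x - v))\<^sup>2 - 2 * t * ((x - v) \<bullet> w) + t * (t * (w \<bullet> w))"
      unfolding power2_norm_eq_inner inner_diff_left[of "x - v"] inner_diff_right[of _ "x - v"]
      by (simp add: inner_commute algebra_simps)
    also have "\<dots> = (norm (x - v))\<^sup>2 - ((x - v) \<bullet> w)\<^sup>2 / (w \<bullet> w)"
      using w0 by (simp add: t_def power2_eq_square)
    finally have "((x - v) \<bullet> w)\<^sup>2 / (w \<bullet> w) \<le> 0" by simp
    moreover have "w \<bullet> w > 0" using w0 inner_ge_zero[of w] by linarith
    ultimately show False using neq by (simp add: divide_le_0_iff)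
  qed
  have "\<langle>x - v | w\<rangle> = 0" if "w \<in> V" for w
  proof -
    have "\<langle>w | x - v\<rangle> = 0"
      using real0[OF that] real0[OF closed_subspaceD(3)[OF assms that, of \<i>]]
      unfolding cinner_eq_inner by (simp add: inner_commute complex_eq_iff)
    then show ?thesis using cinner_eq_zero_sym by blast
  qed
  then show thesis using that v(1) by blast
qed

lemma projectionsD:
  assumes "P \<in> projections K" "x \<in> K"
  shows "P x \<in> K" "P (P x) = P x" "y \<in> K \<Longrightarrow> \<langle>P x | y\<rangle> = \<langle>x | P y\<rangle>"
    "y \<in> K \<Longrightarrow> P (x + y) = P x + P y" "P (c *\<^sub>C x) = c *\<^sub>C P x"
  using assms unfolding projections_def bounded_ops_def by (auto simp: PiE_def Pi_def)

lemma projection_fixes_image: "P \<in> projections K \<Longrightarrow> x \<in> P ` K \<Longrightarrow> P x = x"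
  using projectionsD(2) by blast

lemma projection_orthogonal:
  assumes "P \<in> projections K" "x \<in> K" "w \<in> P ` K"
  shows "\<langle>x - P x | w\<rangle> = 0"
proof -
  have "w \<in> K" "P w = w"
    using assms projectionsD(1) projection_fixes_image by blast+
  then show ?thesis
    using projectionsD(3)[OF assms(1,2), of w] by (simp add: cinner_diff_left)
qed

lemma orthogonal_decomposition_unique:
  assumes V: "closed_subspace V" and "v \<in> V" "v' \<in> V"
    and "\<And>w. w \<in> V \<Longrightarrow> \<langle>x - v | w\<rangle> = 0" "\<And>w. w \<in> V \<Longrightarrow> \<langle>x - v' | w\<rangle> = 0"
  shows "v = v'"
proof -
  have "v - v' \<in> V" using closed_subspaceD(4)[OF V] assms by blast
  then have "\<langle>v - v' | v - v'\<rangle> = 0"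
    using assms(4,5)[of "v - v'"] by (simp add: cinner_diff_left)
  then show ?thesis using cinner_self_eq_zero[of "v - v'"] by simp
qed

text \<open>
  The range of a projection is closed because it is an orthogonal complement: inside \<open>K\<close> it consists of
  the vectors orthogonal to all \<open>y - P y\<close>.
\<close>

lemma closed_subspace_projection_image:
  assumes P: "P \<in> projections K" and K: "closed_subspace K"
  shows "closed_subspace (P ` K)" "P ` K \<subseteq> K"
proof -
  note KD = closed_subspaceD[OF K]
  show sub: "P ` K \<subseteq> K" using projectionsD(1)[OF P] by blast
  have img: "P ` K = {x\<in>K. \<forall>y\<in>K. \<langle>y - P y | x\<rangle> = 0}"
  proof (intro equalityI subsetI)
    fix x assume "x \<in> P ` K"
    then show "x \<in> {x\<in>K. \<forall>y\<in>K. \<langle>y - P y | x\<rangle> = 0}"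
      using sub projection_orthogonal[OF P] by auto
  next
    fix x assume x: "x \<in> {x\<in>K. \<forall>y\<in>K. \<langle>y - P y | x\<rangle> = 0}"
    then have xK: "x \<in> K" by blast
    have "P x \<in> K" using projectionsD(1)[OF P xK] .
    then have "x - P x \<in> K" using KD(4) xK by blast
    have "\<langle>x - P x | x\<rangle> = 0" using x xK by blast
    moreover have "\<langle>x - P x | P x\<rangle> = 0"
      using projection_orthogonal[OF P xK] xK by blast
    ultimately have "\<langle>x - P x | x - P x\<rangle> = 0" by (simp add: cinner_diff_right)
    then have "x = P x" using cinner_self_eq_zero[of "x - P x"] by simp
    then show "x \<in> P ` K" using xK by blast
  qed
  have "P ` K = K \<inter> {x. \<forall>y\<in>(\<lambda>y. y - P y) ` K. \<langle>y | x\<rangle> = 0}"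
    unfolding img by auto
  then show "closed_subspace (P ` K)"
    by (simp only: closed_subspace_Int[OF K closed_subspace_orthogonal])
qed

lemma projection_eqI:
  assumes "P \<in> projections K" "Q \<in> projections K" "closed_subspace K" "P ` K = Q ` K"
  shows "P = Q"
proof
  fix x
  show "P x = Q x"
  proof (cases "x \<in> K")
    case True
    show ?thesis
    proof (rule orthogonal_decomposition_unique)
      show "closed_subspace (P ` K)"
        by (rule closed_subspace_projection_image[OF assms(1,3)])
      show "P x \<in> P ` K" "Q x \<in> P ` K"
        using True assms(4) by auto
      show "\<langle>x - P x | w\<rangle> = 0" "\<langle>x - Q x | w\<rangle> = 0" if "w \<in> P ` K" for w
        using projection_orthogonal[OF assms(1) True] projection_orthogonal[OF assms(2) True]
          that assms(4) by blast+
    qed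
  next
    case False
    then show ?thesis
      using assms(1,2) unfolding projections_def bounded_ops_def by (auto simp: PiE_def extensional_def)
  qed
qed

lemma projection_exists:
  assumes K: "closed_subspace K" and V: "closed_subspace V" and "V \<subseteq> K"
  shows "\<exists>P. P \<in> projections K \<and> P ` K = V"
proof -
  have "\<forall>x. \<exists>v. v \<in> V \<and> (\<forall>w\<in>V. \<langle>x - v | w\<rangle> = 0)"
    using orthogonal_decomposition[OF V] by metis
  then obtain p where pV: "\<And>x. p x \<in> V" and p: "\<And>x w. w \<in> V \<Longrightarrow> \<langle>x - p x | w\<rangle> = 0"
    by metis
  note VD = closed_subspaceD[OF V] and KD = closed_subspaceD[OF K]
  have p': "\<langle>w | x - p x\<rangle> = 0" if "w \<in> V" for x w
    using p[OF that] cinner_eq_zero_sym by blast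
  have uniq: "p x = v" if "v \<in> V" "\<And>w. w \<in> V \<Longrightarrow> \<langle>x - v | w\<rangle> = 0" for x v
    by (rule orthogonal_decomposition_unique[OF V pV that(1) p that(2)])
  have add: "p (x + y) = p x + p y" for x y
  proof (rule uniq)
    fix w assume "w \<in> V"
    then show "\<langle>x + y - (p x + p y) | w\<rangle> = 0"
      using p[of w x] p[of w y] by (simp add: cinner_diff_left cinner_add_left)
  qed (intro VD(2) pV)
  have scale: "p (c *\<^sub>C x) = c *\<^sub>C p x" for c x
  proof (rule uniq)
    fix w assume "w \<in> V"
    then show "\<langle>c *\<^sub>C x - c *\<^sub>C p x | w\<rangle> = 0"
      using p[of w x] by (simp add: cinner_diff_left cinner_scaleC_left)
  qed (intro VD(3) pV)
  have fix_V: "p v = v" if "v \<in> V" for v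
    by (rule uniq) (use that in auto)
  have self: "\<langle>p x | y\<rangle> = \<langle>x | p y\<rangle>" for x y
    using p[OF pV, of x y] p'[OF pV, of x y] by (simp add: cinner_diff_left cinner_diff_right)
  have bound: "norm (p x) \<le> 1 * norm x" for x
  proof -
    have "p x \<bullet> p x = x \<bullet> p x"
      using p[OF pV, of x x] Re_cinner by (metis cinner_diff_left eq_iff_diff_eq_0)
    then have "norm (p x) * norm (p x) \<le> norm x * norm (p x)"
      using norm_cauchy_schwarz[of x "p x"] by (simp only: power2_norm_eq_inner flip: power2_eq_square)
    then show ?thesis
      by (cases "norm (p x) = 0") (simp_all add: mult_le_cancel_right)
  qed
  have "restrict p K \<in> projections K"
  proof -
    have pK: "p x \<in> K" for x
      using pV \<open>V \<subseteq> K\<close> by blast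
    have "\<exists>M. \<forall>x\<in>K. norm (restrict p K x) \<le> M * norm x"
      using bound by (intro exI[of _ 1]) simp
    then show ?thesis
      unfolding projections_def bounded_ops_def
      by (simp add: pK KD(2,3) add scale self fix_V[OF pV])
  qed
  moreover have "restrict p K ` K = V"
  proof -
    have "v \<in> p ` K" if "v \<in> V" for v
      using that fix_V[OF that] \<open>V \<subseteq> K\<close> by (metis imageI subsetD)
    then have "p ` K = V" using pV by blast
    then show ?thesis by simp
  qed
  ultimately show ?thesis by blast
qed

lemma proj_onto:
  assumes K: "closed_subspace K" and V: "closed_subspace V" and "V \<subseteq> K"
  shows "proj_onto K V \<in> projections K" "proj_onto K V ` K = V"
proof -
  have "\<exists>!P. P \<in> projections K \<and> P ` K = V"
    using projection_exists[OF assms] projection_eqI[OF _ _ K] by metis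
  from theI'[OF this] show "proj_onto K V \<in> projections K" "proj_onto K V ` K = V"
    unfolding proj_onto_def by blast+
qed

lemma proj_onto_image:
  assumes "P \<in> projections K" "closed_subspace K"
  shows "proj_onto K (P ` K) = P"
  using projection_eqI[OF proj_onto(1) assms(1,2) proj_onto(2)]
    closed_subspace_projection_image[OF assms] assms(2) by blast


lemma proj_onto_UNIV:
  assumes "closed_subspace K"
  shows "proj_onto UNIV K w \<in> K" "x \<in> K \<Longrightarrow> \<langle>x | w - proj_onto UNIV K w\<rangle> = 0"
    "x \<in> K \<Longrightarrow> proj_onto UNIV K x = x"
proof -
  note P = proj_onto[OF closed_subspace_UNIV assms subset_UNIV]
  show "proj_onto UNIV K w \<in> K" using P(2) by blast
  show "\<langle>x | w - proj_onto UNIV K w\<rangle> = 0" if "x \<in> K"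
    using projection_orthogonal[OF P(1) UNIV_I] that P(2) cinner_eq_zero_sym
    by blast
  show "proj_onto UNIV K x = x" if "x \<in> K"
    using projection_fixes_image[OF P(1)] that P(2) by simp
qed

text \<open>
  A closed subspace is its own double orthogonal complement. Together with adjoints this turns
  invariance statements into statements about inner products.
\<close>

lemma closed_subspace_mem_orthogonal:
  assumes "closed_subspace V" and "\<And>y. (\<And>v. v \<in> V \<Longrightarrow> \<langle>v | y\<rangle> = 0) \<Longrightarrow> \<langle>x | y\<rangle> = 0"
  shows "x \<in> V"
proof -
  let ?y = "x - proj_onto UNIV V x"
  have "\<langle>x | ?y\<rangle> = 0"
    using assms proj_onto_UNIV(2) by blast
  moreover have "\<langle>proj_onto UNIV V x | ?y\<rangle> = 0"
    using proj_onto_UNIV[OF assms(1)] by blast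
  ultimately have "\<langle>?y | ?y\<rangle> = 0" by (simp add: cinner_diff_left)
  then have "x = proj_onto UNIV V x" using cinner_self_eq_zero[of ?y] by simp
  then show ?thesis using proj_onto_UNIV(1)[OF assms(1), of x] by simp
qed

lemma proj_orthogonal_iff:
  assumes M: "closed_subspace M" and N: "closed_subspace N"
  shows "proj_orthogonal UNIV (proj_onto UNIV M) (proj_onto UNIV N)
    \<longleftrightarrow> (\<forall>m\<in>M. \<forall>n\<in>N. \<langle>m | n\<rangle> = 0)"
proof
  assume *: "proj_orthogonal UNIV (proj_onto UNIV M) (proj_onto UNIV N)"
  show "\<forall>m\<in>M. \<forall>n\<in>N. \<langle>m | n\<rangle> = 0"
  proof (intro ballI)
    fix m n assume "m \<in> M" "n \<in> N"
    then have "proj_onto UNIV M n = 0"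
      using * proj_onto_UNIV(3)[OF N] unfolding proj_orthogonal_def by (metis UNIV_I)
    then show "\<langle>m | n\<rangle> = 0"
      using proj_onto_UNIV(2)[OF M \<open>m \<in> M\<close>, of n] by simp
  qed
next
  assume *: "\<forall>m\<in>M. \<forall>n\<in>N. \<langle>m | n\<rangle> = 0"
  have "proj_onto UNIV M n = 0" if "n \<in> N" for n
  proof -
    let ?p = "proj_onto UNIV M n"
    have p: "?p \<in> M" by (rule proj_onto_UNIV(1)[OF M])
    have "\<langle>?p | ?p\<rangle> = 0"
      using proj_onto_UNIV(2)[OF M p, of n] * p that by (simp add: cinner_diff_right)
    then show ?thesis using cinner_self_eq_zero by blast
  qed
  then show "proj_orthogonal UNIV (proj_onto UNIV M) (proj_onto UNIV N)"
    using proj_onto_UNIV(1)[OF N] unfolding proj_orthogonal_def by blast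
qed

lemma inj_on_proj_onto:
  assumes "closed_subspace K"
  shows "inj_on (proj_onto K) {V. closed_subspace V \<and> V \<subseteq> K}"
  using proj_onto(2)[OF assms] by (intro inj_onI) (metis (mono_tags, lifting) mem_Collect_eq)

section \<open>Adjoints of bounded operators\<close>

lemma bounded_opsD:
  assumes "T \<in> bounded_ops UNIV UNIV"
  shows "T (x + y) = T x + T y" "T (c *\<^sub>C x) = c *\<^sub>C T x" "T 0 = 0" "T (x - y) = T x - T y"
    "\<exists>M. \<forall>x. norm (T x) \<le> M * norm x"
proof -
  show add: "T (x + y) = T x + T y" for x y
    using assms unfolding bounded_ops_def by simp
  show "T (c *\<^sub>C x) = c *\<^sub>C T x" "\<exists>M. \<forall>x. norm (T x) \<le> M * norm x"
    using assms unfolding bounded_ops_def by simp_all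
  show "T 0 = 0" using add[of 0 0] by simp
  show "T (x - y) = T x - T y" using add[of "x - y" y] by (simp add: algebra_simps)
qed

lemma bounded_opsI:
  assumes "\<And>x y. T (x + y) = T x + T y" "\<And>c x. T (c *\<^sub>C x) = c *\<^sub>C T x"
    "\<And>x. norm (T x) \<le> M * norm x"
  shows "T \<in> bounded_ops UNIV UNIV"
  using assms unfolding bounded_ops_def by auto

lemma bounded_ops_comp:
  assumes "S \<in> bounded_ops UNIV UNIV" "T \<in> bounded_ops UNIV UNIV"
  shows "S \<circ> T \<in> bounded_ops UNIV UNIV"
proof -
  obtain M where M: "\<And>x. norm (S x) \<le> M * norm x"
    using bounded_opsD(5)[OF assms(1)] by blast
  obtain N where N: "\<And>x. norm (T x) \<le> N * norm x"
    using bounded_opsD(5)[OF assms(2)] by blast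
  have "norm ((S \<circ> T) x) \<le> (\<bar>M\<bar> * N) * norm x" for x
  proof -
    have "norm (S (T x)) \<le> \<bar>M\<bar> * norm (T x)"
      using M[of "T x"] by (meson abs_ge_self mult_right_mono norm_ge_zero order_trans)
    also have "\<dots> \<le> \<bar>M\<bar> * (N * norm x)"
      by (rule mult_left_mono[OF N abs_ge_zero])
    finally show ?thesis by (simp add: mult.assoc)
  qed
  then show ?thesis
    by (intro bounded_opsI) (simp_all add: bounded_opsD(1,2)[OF assms(1)] bounded_opsD(1,2)[OF assms(2)])
qed

lemma closed_subspace_vimage:
  assumes T: "T \<in> bounded_ops UNIV UNIV" and V: "closed_subspace V"
  shows "closed_subspace {x. T x \<in> V}"
proof (rule closed_subspaceI)
  obtain M where "\<And>x. norm (T x) \<le> M * norm x"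
    using bounded_opsD(5)[OF T] by blast
  then have "bounded_linear T"
    using bounded_opsD(1,2)[OF T]
    by (intro bounded_linear_intro[where K = M]) (simp_all add: mult.commute flip: scaleC_of_real)
  then have "closed (T -` V)"
    using closed_subspaceD(5)[OF V] by (simp add: closed_vimage linear_continuous_on)
  then show "closed {x. T x \<in> V}" by (simp add: vimage_def)
qed (simp_all add: bounded_opsD[OF T] closed_subspaceD[OF V])

text \<open>
  The Riesz representation theorem for the functional \<open>x \<mapsto> \<langle>T x | y\<rangle>\<close>: unless it vanishes, the
  representing vector is a multiple of any nonzero vector orthogonal to its kernel.
\<close>

lemma bounded_functional_representation:
  assumes T: "T \<in> bounded_ops UNIV UNIV"
  shows "\<exists>z. \<forall>x. \<langle>T x | y\<rangle> = \<langle>x | z\<rangle>"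
proof -
  define N where "N = {x. T x \<in> {v. \<forall>w\<in>{y}. \<langle>w | v\<rangle> = 0}}"
  have N: "closed_subspace N"
    unfolding N_def by (intro closed_subspace_vimage T closed_subspace_orthogonal)
  have N_iff: "x \<in> N \<longleftrightarrow> \<langle>T x | y\<rangle> = 0" for x
    unfolding N_def using cinner_eq_zero_sym by auto
  show ?thesis
  proof (cases "\<forall>x. x \<in> N")
    case True
    then show ?thesis using N_iff by (intro exI[of _ 0]) simp
  next
    case False
    then obtain u where u: "u \<notin> N" by blast
    obtain v where v: "v \<in> N" "\<And>w. w \<in> N \<Longrightarrow> \<langle>u - v | w\<rangle> = 0"
      using orthogonal_decomposition[OF N] by blast
    define e where "e = u - v"
    have "e \<noteq> 0" using u v(1) unfolding e_def by auto
    have e: "\<langle>e | e\<rangle> \<noteq> 0" using \<open>e \<noteq> 0\<close> cinner_self_eq_zero by blast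
    have "\<langle>T x | y\<rangle> = \<langle>x | cnj (\<langle>T e | y\<rangle> / \<langle>e | e\<rangle>) *\<^sub>C e\<rangle>" for x
    proof -
      have "\<langle>T e | y\<rangle> *\<^sub>C x - \<langle>T x | y\<rangle> *\<^sub>C e \<in> N"
        unfolding N_iff
        by (simp add: bounded_opsD[OF T] cinner_diff_left cinner_scaleC_left)
      then have "\<langle>\<langle>T e | y\<rangle> *\<^sub>C x - \<langle>T x | y\<rangle> *\<^sub>C e | e\<rangle> = 0"
        using v(2) cinner_eq_zero_sym unfolding e_def by blast
      then have "\<langle>T e | y\<rangle> * \<langle>x | e\<rangle> = \<langle>T x | y\<rangle> * \<langle>e | e\<rangle>"
        by (simp add: cinner_diff_left cinner_scaleC_left)
      then show ?thesis
        using e by (simp add: cinner_scaleC_right field_simps)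
    qed
    then show ?thesis by blast
  qed
qed

lemma cadjoint_eqI:
  assumes "S \<in> bounded_ops UNIV UNIV" "\<And>x y. \<langle>T x | y\<rangle> = \<langle>x | S y\<rangle>"
  shows "cadjoint T = S"
  unfolding cadjoint_def
proof (rule the_equality)
  fix R assume "R \<in> bounded_ops UNIV UNIV \<and> (\<forall>x y. \<langle>T x | y\<rangle> = \<langle>x | R y\<rangle>)"
  then show "R = S" using assms(2) by (intro ext cinner_ext) metis
qed (use assms in blast)

lemma cadjoint:
  assumes T: "T \<in> bounded_ops UNIV UNIV"
  shows "cadjoint T \<in> bounded_ops UNIV UNIV" "\<langle>T x | y\<rangle> = \<langle>x | cadjoint T y\<rangle>"
    "\<langle>cadjoint T y | x\<rangle> = \<langle>y | T x\<rangle>"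
proof -
  obtain S where S: "\<And>x y. \<langle>T x | y\<rangle> = \<langle>x | S y\<rangle>"
    using bounded_functional_representation[OF T] by metis
  obtain M where M: "\<And>x. norm (T x) \<le> M * norm x"
    using bounded_opsD(5)[OF T] by blast
  have S_bounded: "S \<in> bounded_ops UNIV UNIV"
  proof (rule bounded_opsI)
    show "S (x + y) = S x + S y" for x y
      by (rule cinner_ext) (simp add: S[symmetric] cinner_add_right)
    show "S (c *\<^sub>C x) = c *\<^sub>C S x" for c x
      by (rule cinner_ext) (simp add: S[symmetric] cinner_scaleC_right)
    show "norm (S y) \<le> \<bar>M\<bar> * norm y" for y
    proof -
      have "norm (S y) * norm (S y) = T (S y) \<bullet> y"
        using S[of "S y" y] by (metis Re_cinner power2_eq_square power2_norm_eq_inner)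
      also have "\<dots> \<le> norm (T (S y)) * norm y" by (rule norm_cauchy_schwarz)
      also have "\<dots> \<le> (M * norm (S y)) * norm y" by (intro mult_right_mono M norm_ge_zero)
      also have "\<dots> \<le> (\<bar>M\<bar> * norm (S y)) * norm y" by (intro mult_right_mono norm_ge_zero) simp
      finally have "norm (S y) * norm (S y) \<le> (\<bar>M\<bar> * norm y) * norm (S y)"
        by (simp add: mult_ac)
      then show ?thesis
        by (cases "S y = 0") (simp_all add: mult_le_cancel_right)
    qed
  qed
  have "cadjoint T = S" by (rule cadjoint_eqI[OF S_bounded S])
  then show "cadjoint T \<in> bounded_ops UNIV UNIV" and *: "\<langle>T x | y\<rangle> = \<langle>x | cadjoint T y\<rangle>" for x y
    using S_bounded S by simp_all
  show "\<langle>cadjoint T y | x\<rangle> = \<langle>y | T x\<rangle>"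
    using *[of x y] by (metis cinner_commute)
qed

lemma cadjoint_cadjoint:
  assumes "T \<in> bounded_ops UNIV UNIV"
  shows "cadjoint (cadjoint T) = T"
  by (rule cadjoint_eqI[OF assms cadjoint(3)[OF assms]])

section \<open>Normalizing subspaces\<close>

text \<open>
  These are the ternary rings of operators, in the purely algebraic sense.
\<close>

definition ternary_space :: "('a::separable_chilbert \<Rightarrow> 'b::separable_chilbert) set \<Rightarrow> bool" where
  "ternary_space \<U> \<longleftrightarrow> operator_subspace \<U> \<and> normalizing \<U>"

text \<open>
  This is the map \<open>\<chi>\<close> on ranges: it sends the range of \<open>P\<close> to the range of \<open>\<chi>(P)\<close>. Applied to
  \<open>UNIV\<close> it gives \<open>K2\<close>, and for the adjoints it gives \<open>K1\<close>.
\<close>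

definition image_span ::
    "('a::separable_chilbert \<Rightarrow> 'b::separable_chilbert) set \<Rightarrow> 'a set \<Rightarrow> 'b set" where
  "image_span \<U> V = closed_span {S x | S x. S \<in> \<U> \<and> x \<in> V}"

lemma ternary_spaceD:
  assumes "ternary_space \<U>"
  shows "S \<in> \<U> \<Longrightarrow> S \<in> bounded_ops UNIV UNIV" "S \<in> \<U> \<Longrightarrow> T \<in> \<U> \<Longrightarrow> (\<lambda>x. S x + T x) \<in> \<U>"
    "T \<in> \<U> \<Longrightarrow> (\<lambda>x. c *\<^sub>C T x) \<in> \<U>" "S \<in> \<U> \<Longrightarrow> T \<in> \<U> \<Longrightarrow> R \<in> \<U> \<Longrightarrow> S \<circ> cadjoint T \<circ> R \<in> \<U>"
  using assms unfolding ternary_space_def operator_subspace_def normalizing_def by blast+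

lemma closed_subspace_image_span [simp]: "closed_subspace (image_span \<U> V)"
  by (simp add: image_span_def)

lemma image_span_mem: "S \<in> \<U> \<Longrightarrow> x \<in> V \<Longrightarrow> S x \<in> image_span \<U> V"
  unfolding image_span_def by (rule subsetD[OF closed_span_superset]) blast

lemma image_span_minimal:
  "closed_subspace W \<Longrightarrow> (\<And>S x. S \<in> \<U> \<Longrightarrow> x \<in> V \<Longrightarrow> S x \<in> W) \<Longrightarrow> image_span \<U> V \<subseteq> W"
  unfolding image_span_def by (rule closed_span_minimal) auto

lemma image_span_mono: "V \<subseteq> W \<Longrightarrow> image_span \<U> V \<subseteq> image_span \<U> W"
  by (rule image_span_minimal) (auto intro: image_span_mem)

lemma adjoints_adjoints:
  assumes "\<U> \<subseteq> bounded_ops UNIV UNIV"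
  shows "adjoints (adjoints \<U>) = \<U>"
proof -
  have "cadjoint (cadjoint T) = T" if "T \<in> \<U>" for T
    using cadjoint_cadjoint assms that by blast
  then show ?thesis unfolding adjoints_def image_image by simp
qed

text \<open>
  The adjoints exchange the roles of the two Hilbert spaces, so that a statement about one of them
  yields the corresponding statement about the other.
\<close>

lemma ternary_space_adjoints:
  assumes U: "ternary_space \<U>"
  shows "ternary_space (adjoints \<U>)"
proof -
  note UD = ternary_spaceD[OF U]
  have bo: "adjoints \<U> \<subseteq> bounded_ops UNIV UNIV"
    unfolding adjoints_def using UD(1) cadjoint(1) by blast
  have "(\<lambda>x. 0) \<in> adjoints \<U>"
  proof -
    have "(\<lambda>x. 0) \<in> \<U>" using U unfolding ternary_space_def operator_subspace_def by blast
    moreover have "cadjoint (\<lambda>x. 0 :: 'b) = (\<lambda>x. 0 :: 'a)"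
      by (intro cadjoint_eqI bounded_opsI[where M = 0]) simp_all
    ultimately show ?thesis unfolding adjoints_def by (metis imageI)
  qed
  moreover have "(\<lambda>x. cadjoint S x + cadjoint T x) \<in> adjoints \<U>" if "S \<in> \<U>" "T \<in> \<U>" for S T
  proof -
    have "cadjoint (\<lambda>x. S x + T x) y = cadjoint S y + cadjoint T y" for y
      by (rule cinner_ext)
        (simp add: cinner_add_left cinner_add_right flip: that[THEN UD(1), THEN cadjoint(2)]
          UD(2)[OF that, THEN UD(1), THEN cadjoint(2)])
    then have "cadjoint (\<lambda>x. S x + T x) = (\<lambda>x. cadjoint S x + cadjoint T x)" by (rule ext)
    then show ?thesis
      unfolding adjoints_def using UD(2)[OF that] by (metis imageI)
  qed
  moreover have "(\<lambda>x. c *\<^sub>C cadjoint T x) \<in> adjoints \<U>" if "T \<in> \<U>" for c T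
  proof -
    have "cadjoint (\<lambda>x. cnj c *\<^sub>C T x) y = c *\<^sub>C cadjoint T y" for y
      by (rule cinner_ext)
        (simp add: cinner_scaleC_left cinner_scaleC_right flip: that[THEN UD(1), THEN cadjoint(2)]
          UD(3)[OF that, THEN UD(1), THEN cadjoint(2)])
    then have "cadjoint (\<lambda>x. cnj c *\<^sub>C T x) = (\<lambda>x. c *\<^sub>C cadjoint T x)" by (rule ext)
    then show ?thesis
      unfolding adjoints_def using UD(3)[OF that] by (metis imageI)
  qed
  moreover have "cadjoint R \<circ> cadjoint (cadjoint T) \<circ> cadjoint S \<in> adjoints \<U>"
    if "S \<in> \<U>" "T \<in> \<U>" "R \<in> \<U>" for R S T
  proof -
    note bo' = that[THEN UD(1)]
    have "cadjoint (S \<circ> cadjoint T \<circ> R) = cadjoint R \<circ> cadjoint (cadjoint T) \<circ> cadjoint S"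
      by (rule cadjoint_eqI)
        (simp_all add: bounded_ops_comp cadjoint bo' cadjoint_cadjoint)
    then show ?thesis
      unfolding adjoints_def using UD(4)[OF that] by (metis imageI)
  qed
  ultimately show ?thesis
    using bo unfolding ternary_space_def operator_subspace_def normalizing_def
    by (simp add: adjoints_def)
qed

text \<open>
  The orthogonal complement of \<open>[\<U> H]\<close> is annihilated by every adjoint.
\<close>

lemma adjoint_projection:
  assumes "T \<in> \<U>" "T \<in> bounded_ops UNIV UNIV"
  shows "cadjoint T (proj_onto UNIV (image_span \<U> UNIV) w) = cadjoint T w"
proof -
  let ?K = "image_span \<U> UNIV"
  have "\<langle>T x | w - proj_onto UNIV ?K w\<rangle> = 0" for x
    using proj_onto_UNIV(2)[OF closed_subspace_image_span image_span_mem[OF assms(1) UNIV_I]] .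
  then show ?thesis
    by (intro cinner_ext) (simp add: cinner_diff_right cadjoint(2)[OF assms(2), symmetric])
qed

text \<open>
  Let \<open>W\<close> be the closed span of the vectors \<open>S T\<^sup>* w\<close> and \<open>p\<close> the component of \<open>w\<close> in \<open>[\<U> H]\<close>. As \<open>\<U>\<close> is
  normalizing, \<open>T T\<^sup>*\<close> leaves \<open>W\<close> invariant; as \<open>T\<^sup>* p = T\<^sup>* w\<close>, it also maps \<open>p\<close> into \<open>W\<close>. So for the
  projection \<open>q\<close> of \<open>p\<close> onto \<open>W\<close> the vector \<open>T T\<^sup>* (p - q)\<close> is in \<open>W\<close>, hence orthogonal to \<open>p - q\<close>, which
  means \<open>T\<^sup>* (p - q) = 0\<close> for every \<open>T\<close>. Then \<open>p - q\<close> is both in \<open>[\<U> H]\<close> and orthogonal to it.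
\<close>

lemma nondegenerate:
  assumes U: "ternary_space \<U>" and V: "closed_subspace V"
    and w: "\<And>S T. S \<in> \<U> \<Longrightarrow> T \<in> \<U> \<Longrightarrow> S (cadjoint T w) \<in> V"
  shows "proj_onto UNIV (image_span \<U> UNIV) w \<in> V"
proof -
  note UD = ternary_spaceD[OF U]
  define K where "K = image_span \<U> UNIV"
  define W where "W = image_span \<U> {cadjoint T w | T. T \<in> \<U>}"
  define p where "p = proj_onto UNIV K w"
  define q where "q = proj_onto UNIV W p"
  have K: "closed_subspace K" and W: "closed_subspace W"
    by (simp_all add: K_def W_def)
  have "W \<subseteq> V" unfolding W_def using w by (intro image_span_minimal V) auto
  have "W \<subseteq> K" unfolding W_def K_def by (rule image_span_mono) simp
  have inv: "S (cadjoint T v) \<in> W" if "S \<in> \<U>" "T \<in> \<U>" "v \<in> W" for S T v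
  proof -
    note bo = that(1,2)[THEN UD(1)]
    have "W \<subseteq> {v. (S \<circ> cadjoint T) v \<in> W}"
      unfolding W_def
    proof (intro image_span_minimal closed_subspace_vimage bounded_ops_comp bo cadjoint(1))
      fix R x assume "R \<in> \<U>" "x \<in> {cadjoint T w | T. T \<in> \<U>}"
      then show "R x \<in> {v. (S \<circ> cadjoint T) v \<in> image_span \<U> {cadjoint T w | T. T \<in> \<U>}}"
        using image_span_mem[OF UD(4)[OF that(1,2)]] by simp
    qed simp
    then show ?thesis using that(3) by auto
  qed
  have "cadjoint T (p - q) = 0" if T: "T \<in> \<U>" for T
  proof -
    note bo = UD(1)[OF T]
    have qW: "q \<in> W" unfolding q_def by (rule proj_onto_UNIV(1)[OF W])
    have "cadjoint T p = cadjoint T w"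
      unfolding p_def K_def by (rule adjoint_projection[OF T bo])
    then have "T (cadjoint T (p - q)) = T (cadjoint T w) - T (cadjoint T q)"
      by (simp add: bounded_opsD(4)[OF cadjoint(1)[OF bo]] bounded_opsD(4)[OF bo])
    also have "\<dots> \<in> W"
    proof (rule closed_subspaceD(4)[OF W])
      show "T (cadjoint T w) \<in> W"
        unfolding W_def using T by (intro image_span_mem) auto
    qed (rule inv[OF T T qW])
    finally have "\<langle>T (cadjoint T (p - q)) | p - q\<rangle> = 0"
      unfolding q_def by (rule proj_onto_UNIV(2)[OF W])
    then show ?thesis
      by (simp add: cadjoint(2)[OF bo] cinner_self_eq_zero)
  qed
  then have ortho: "\<langle>T x | p - q\<rangle> = 0" if "T \<in> \<U>" for T x
    using that by (simp add: cadjoint(2)[OF UD(1)])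
  have "\<langle>k | p - q\<rangle> = 0" if "k \<in> K" for k
  proof (rule orthogonal_closed_span)
    show "k \<in> closed_span {S x | S x. S \<in> \<U> \<and> x \<in> UNIV}"
      using that unfolding K_def image_span_def .
  qed (use ortho in blast)
  moreover have "p - q \<in> K"
    unfolding p_def q_def using proj_onto_UNIV(1)[OF W] \<open>W \<subseteq> K\<close>
    by (intro closed_subspaceD(4)[OF K] proj_onto_UNIV(1)[OF K]) blast
  ultimately have "p = q"
    using cinner_self_eq_zero[of "p - q"] by auto
  then show ?thesis
    using proj_onto_UNIV(1)[OF W, of p] \<open>W \<subseteq> V\<close> unfolding p_def q_def K_def by auto
qed

lemma nondegenerate_adjoints:
  assumes U: "ternary_space \<U>" and V: "closed_subspace V"
    and w: "\<And>S T. S \<in> \<U> \<Longrightarrow> T \<in> \<U> \<Longrightarrow> cadjoint S (T w) \<in> V"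
  shows "proj_onto UNIV (image_span (adjoints \<U>) UNIV) w \<in> V"
proof (rule nondegenerate[OF ternary_space_adjoints[OF U] V])
  fix S T assume "S \<in> adjoints \<U>" "T \<in> adjoints \<U>"
  then show "S (cadjoint T w) \<in> V"
    using w cadjoint_cadjoint ternary_spaceD(1)[OF U] unfolding adjoints_def by fastforce
qed

lemma operator_projection:
  assumes U: "ternary_space \<U>" and T: "T \<in> \<U>"
  shows "T (proj_onto UNIV (image_span (adjoints \<U>) UNIV) w) = T w"
proof -
  note bo = ternary_spaceD(1)[OF U T]
  have "cadjoint T \<in> adjoints \<U>" using T unfolding adjoints_def by blast
  from adjoint_projection[OF this cadjoint(1)[OF bo]] show ?thesis
    by (simp add: cadjoint_cadjoint[OF bo])
qed

section \<open>Invariant subspaces and reflexivity\<close>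

text \<open>
  These are the ranges of the projections in \<open>Lat\<close>. For a compression to \<open>K\<close> the members are the
  subspaces of \<open>K\<close> that are invariant after projecting back to \<open>K\<close>.
\<close>

definition inv_subspaces :: "'a::separable_chilbert set \<Rightarrow> ('a \<Rightarrow> 'a) set \<Rightarrow> 'a set set" where
  "inv_subspaces K \<X> = {V. closed_subspace V \<and> V \<subseteq> K \<and> (\<forall>X\<in>\<X>. \<forall>v\<in>V. X v \<in> V)}"

lemma Lat_eq_inv_subspaces:
  assumes K: "closed_subspace K" and X: "\<And>X x. X \<in> \<X> \<Longrightarrow> x \<in> K \<Longrightarrow> X x \<in> K"
  shows "Lat K \<X> = proj_onto K ` inv_subspaces K \<X>"
proof -
  have Lat_iff: "L \<in> Lat K \<X> \<longleftrightarrow> L ` K \<in> inv_subspaces K \<X>" if L: "L \<in> projections K" for L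
  proof -
    note img = closed_subspace_projection_image[OF L K]
    have "proj_compl K L (X v) = 0 \<longleftrightarrow> X v \<in> L ` K" if "X \<in> \<X>" "v \<in> K" for X v
    proof -
      have "X v \<in> K" by (rule X[OF that])
      then have "proj_compl K L (X v) = 0 \<longleftrightarrow> L (X v) = X v"
        by (auto simp: proj_compl_def)
      also have "\<dots> \<longleftrightarrow> X v \<in> L ` K"
        using projection_fixes_image[OF L] \<open>X v \<in> K\<close> by (metis imageI)
      finally show ?thesis .
    qed
    then have "L \<in> Lat K \<X> \<longleftrightarrow> (\<forall>X\<in>\<X>. \<forall>x\<in>K. X (L x) \<in> L ` K)"
      using L projectionsD(1)[OF L] by (simp add: Lat_def)
    also have "\<dots> \<longleftrightarrow> L ` K \<in> inv_subspaces K \<X>"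
      unfolding inv_subspaces_def using img by blast
    finally show ?thesis .
  qed
  show ?thesis
  proof (intro equalityI subsetI)
    fix L assume L: "L \<in> Lat K \<X>"
    then have "L \<in> projections K" by (simp add: Lat_def)
    with L show "L \<in> proj_onto K ` inv_subspaces K \<X>"
      using Lat_iff proj_onto_image[OF _ K] by (metis imageI)
  next
    fix L assume "L \<in> proj_onto K ` inv_subspaces K \<X>"
    then obtain V where V: "V \<in> inv_subspaces K \<X>" "L = proj_onto K V" by blast
    then have "closed_subspace V" "V \<subseteq> K" by (simp_all add: inv_subspaces_def)
    from proj_onto[OF K this] show "L \<in> Lat K \<X>"
      using Lat_iff[of L] V by simp
  qed
qed

lemma inv_subspaces_compression:
  "V \<in> inv_subspaces K (compression K \<A>) \<longleftrightarrow>
    closed_subspace V \<and> V \<subseteq> K \<and> (\<forall>A\<in>\<A>. \<forall>v\<in>V. proj_onto UNIV K (A v) \<in> V)"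
  unfolding inv_subspaces_def compression_def by (auto simp: subset_iff)

lemma Lat_compression:
  assumes "closed_subspace K"
  shows "Lat K (compression K \<A>) = proj_onto K ` inv_subspaces K (compression K \<A>)"
  using assms
  by (rule Lat_eq_inv_subspaces) (auto simp: compression_def proj_onto_UNIV(1)[OF assms])

lemma reflexive_algebra_bounded: "reflexive_algebra \<A> \<Longrightarrow> A \<in> \<A> \<Longrightarrow> A \<in> bounded_ops UNIV UNIV"
  unfolding reflexive_algebra_def unital_algebra_def operator_subspace_def by blast

lemma reflexive_algebraI:
  assumes A: "reflexive_algebra \<A>" and X: "X \<in> bounded_ops UNIV UNIV"
    and inv: "\<And>V v. V \<in> inv_subspaces UNIV \<A> \<Longrightarrow> v \<in> V \<Longrightarrow> X v \<in> V"
  shows "X \<in> \<A>"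
proof -
  have "proj_compl UNIV L (X (L x)) = 0" if "L \<in> Lat UNIV \<A>" for L x
  proof -
    have "L \<in> proj_onto UNIV ` inv_subspaces UNIV \<A>"
      using that Lat_eq_inv_subspaces[OF closed_subspace_UNIV UNIV_I, of \<A>] by simp
    then obtain V where V: "V \<in> inv_subspaces UNIV \<A>" and L: "L = proj_onto UNIV V"
      by blast
    then have VC: "closed_subspace V" by (simp add: inv_subspaces_def)
    have "L x \<in> V" unfolding L by (rule proj_onto_UNIV(1)[OF VC])
    then have "X (L x) \<in> V" by (rule inv[OF V])
    then show ?thesis by (simp add: proj_compl_def L proj_onto_UNIV(3)[OF VC])
  qed
  then have "X \<in> {A \<in> bounded_ops UNIV UNIV. \<forall>L\<in>Lat UNIV \<A>. \<forall>x. proj_compl UNIV L (A (L x)) = 0}"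
    using X by blast
  then show ?thesis
    using A unfolding reflexive_algebra_def by simp
qed

lemma range_proj_compl:
  assumes V: "closed_subspace V"
  shows "range (proj_compl UNIV (proj_onto UNIV V)) = {y. \<forall>v\<in>V. \<langle>v | y\<rangle> = 0}"
proof (intro equalityI subsetI)
  fix y assume "y \<in> range (proj_compl UNIV (proj_onto UNIV V))"
  then show "y \<in> {y. \<forall>v\<in>V. \<langle>v | y\<rangle> = 0}"
    using proj_onto_UNIV(2)[OF V] by (auto simp: proj_compl_def)
next
  fix y assume y: "y \<in> {y. \<forall>v\<in>V. \<langle>v | y\<rangle> = 0}"
  let ?p = "proj_onto UNIV V y"
  have p: "?p \<in> V" by (rule proj_onto_UNIV(1)[OF V])
  have "\<langle>?p | ?p\<rangle> = 0"
    using proj_onto_UNIV(2)[OF V p, of y] y p by (simp add: cinner_diff_right)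
  then have "?p = 0" using cinner_self_eq_zero by blast
  then have "y = proj_compl UNIV (proj_onto UNIV V) y" by (simp add: proj_compl_def)
  then show "y \<in> range (proj_compl UNIV (proj_onto UNIV V))" by (rule range_eqI)
qed

lemma Map_eq_image_span: "Map K1 K2 \<U> P = proj_onto K2 (image_span \<U> (P ` K1))"
  by (simp add: Map_def image_span_def)

lemma inv_subspacesD:
  assumes "V \<in> inv_subspaces K \<X>"
  shows "closed_subspace V" "V \<subseteq> K" "X \<in> \<X> \<Longrightarrow> v \<in> V \<Longrightarrow> X v \<in> V"
  using assms by (simp_all add: inv_subspaces_def)

text \<open>
  For \<open>L\<close> with range \<open>V\<close>, orthogonality of \<open>\<chi>(L)\<close> and \<open>\<chi>(L\<^sup>\<bottom>)\<close> means \<open>\<langle>S v | T y\<rangle> = 0\<close> for all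
  \<open>v \<in> V\<close> and all \<open>y\<close> orthogonal to \<open>V\<close>. Moving \<open>T\<close> to the other side, this says that \<open>T\<^sup>* S\<close> leaves \<open>V\<close>
  invariant, and reflexivity turns invariance of all such \<open>V\<close> into membership.
\<close>

lemma orthogonal_images_iff:
  assumes A: "reflexive_algebra \<A>" and U: "ternary_space \<U>"
  shows "(\<forall>L\<in>Lat UNIV \<A>. proj_orthogonal UNIV (Map UNIV UNIV \<U> L) (Map UNIV UNIV \<U> (proj_compl UNIV L)))
    \<longleftrightarrow> (\<forall>S\<in>\<U>. \<forall>T\<in>\<U>. cadjoint T \<circ> S \<in> \<A>)"
proof -
  note bo = ternary_spaceD(1)[OF U]
  have Lat: "Lat UNIV \<A> = proj_onto UNIV ` inv_subspaces UNIV \<A>"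
    by (rule Lat_eq_inv_subspaces) simp_all
  have span_orth_iff:
    "proj_orthogonal UNIV (Map UNIV UNIV \<U> (proj_onto UNIV V)) (Map UNIV UNIV \<U> (proj_compl UNIV (proj_onto UNIV V)))
      \<longleftrightarrow> (\<forall>S\<in>\<U>. \<forall>T\<in>\<U>. \<forall>v\<in>V. \<forall>y. (\<forall>v\<in>V. \<langle>v | y\<rangle> = 0) \<longrightarrow> \<langle>S v | T y\<rangle> = 0)"
    if V: "closed_subspace V" for V
  proof -
    define W where "W = {y. \<forall>v\<in>V. \<langle>v | y\<rangle> = 0}"
    have "proj_orthogonal UNIV (Map UNIV UNIV \<U> (proj_onto UNIV V)) (Map UNIV UNIV \<U> (proj_compl UNIV (proj_onto UNIV V)))
      \<longleftrightarrow> (\<forall>m\<in>image_span \<U> V. \<forall>n\<in>image_span \<U> W. \<langle>m | n\<rangle> = 0)"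
      unfolding Map_eq_image_span range_proj_compl[OF V] W_def
        proj_onto(2)[OF closed_subspace_UNIV V subset_UNIV]
      by (rule proj_orthogonal_iff) simp_all
    also have "\<dots> \<longleftrightarrow> (\<forall>S\<in>\<U>. \<forall>T\<in>\<U>. \<forall>v\<in>V. \<forall>y\<in>W. \<langle>S v | T y\<rangle> = 0)"
    proof
      assume "\<forall>m\<in>image_span \<U> V. \<forall>n\<in>image_span \<U> W. \<langle>m | n\<rangle> = 0"
      then show "\<forall>S\<in>\<U>. \<forall>T\<in>\<U>. \<forall>v\<in>V. \<forall>y\<in>W. \<langle>S v | T y\<rangle> = 0"
        by (simp add: image_span_mem)
    next
      assume *: "\<forall>S\<in>\<U>. \<forall>T\<in>\<U>. \<forall>v\<in>V. \<forall>y\<in>W. \<langle>S v | T y\<rangle> = 0"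
      have "\<langle>m | T y\<rangle> = 0" if "T \<in> \<U>" "y \<in> W" "m \<in> image_span \<U> V" for T y m
        by (rule orthogonal_closed_span[OF _ that(3)[unfolded image_span_def]]) (use * that in auto)
      then have "image_span \<U> W \<subseteq> {n. \<forall>m\<in>image_span \<U> V. \<langle>m | n\<rangle> = 0}"
        by (intro image_span_minimal closed_subspace_orthogonal) simp
      then show "\<forall>m\<in>image_span \<U> V. \<forall>n\<in>image_span \<U> W. \<langle>m | n\<rangle> = 0" by blast
    qed
    finally show ?thesis by (simp add: W_def)
  qed
  show ?thesis
  proof
    assume "\<forall>L\<in>Lat UNIV \<A>. proj_orthogonal UNIV (Map UNIV UNIV \<U> L) (Map UNIV UNIV \<U> (proj_compl UNIV L))"
    then have orth: "\<langle>S v | T y\<rangle> = 0" if "V \<in> inv_subspaces UNIV \<A>" "S \<in> \<U>" "T \<in> \<U>" "v \<in> V"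
      "\<And>v. v \<in> V \<Longrightarrow> \<langle>v | y\<rangle> = 0" for V S T v y
      using span_orth_iff[OF inv_subspacesD(1)[OF that(1)]] that unfolding Lat by simp
    show "\<forall>S\<in>\<U>. \<forall>T\<in>\<U>. cadjoint T \<circ> S \<in> \<A>"
    proof (intro ballI)
      fix S T assume S: "S \<in> \<U>" and T: "T \<in> \<U>"
      show "cadjoint T \<circ> S \<in> \<A>"
      proof (rule reflexive_algebraI[OF A bounded_ops_comp[OF cadjoint(1)[OF bo[OF T]] bo[OF S]]])
        fix V v assume V: "V \<in> inv_subspaces UNIV \<A>" and v: "v \<in> V"
        have "cadjoint T (S v) \<in> V"
        proof (rule closed_subspace_mem_orthogonal[OF inv_subspacesD(1)[OF V]])
          fix y assume "\<And>v. v \<in> V \<Longrightarrow> \<langle>v | y\<rangle> = 0"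
          then show "\<langle>cadjoint T (S v) | y\<rangle> = 0"
            unfolding cadjoint(3)[OF bo[OF T]] by (rule orth[OF V S T v])
        qed
        then show "(cadjoint T \<circ> S) v \<in> V" by simp
      qed
    qed
  next
    assume *: "\<forall>S\<in>\<U>. \<forall>T\<in>\<U>. cadjoint T \<circ> S \<in> \<A>"
    have orth: "\<langle>S v | T y\<rangle> = 0" if V: "V \<in> inv_subspaces UNIV \<A>" and S: "S \<in> \<U>" and T: "T \<in> \<U>"
      and "v \<in> V" "\<forall>v\<in>V. \<langle>v | y\<rangle> = 0" for V S T v y
    proof -
      have "(cadjoint T \<circ> S) v \<in> V"
        by (rule inv_subspacesD(3)[OF V]) (use * that in blast)+
      then show ?thesis
        using that(5) by (simp add: cadjoint(3)[OF bo[OF T], symmetric])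
    qed
    have "proj_orthogonal UNIV (Map UNIV UNIV \<U> (proj_onto UNIV V)) (Map UNIV UNIV \<U> (proj_compl UNIV (proj_onto UNIV V)))"
      if "V \<in> inv_subspaces UNIV \<A>" for V
      unfolding span_orth_iff[OF inv_subspacesD(1)[OF that]] using orth[OF that] by blast
    then show "\<forall>L\<in>Lat UNIV \<A>. proj_orthogonal UNIV (Map UNIV UNIV \<U> L) (Map UNIV UNIV \<U> (proj_compl UNIV L))"
      unfolding Lat by blast
  qed
qed

section \<open>Normalizers and the correspondence of invariant subspaces\<close>

lemma normalizer_adjoints:
  assumes U: "ternary_space \<U>" and N: "\<U> \<subseteq> normalizer \<B> \<A>"
  shows "adjoints \<U> \<subseteq> normalizer \<A> \<B>"
proof
  fix R assume "R \<in> adjoints \<U>"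
  then obtain T where T: "T \<in> \<U>" and R: "R = cadjoint T" unfolding adjoints_def by blast
  have "T \<in> bounded_ops UNIV UNIV" by (rule ternary_spaceD(1)[OF U T])
  then show "R \<in> normalizer \<A> \<B>"
    using T N unfolding normalizer_def R by (auto simp: cadjoint(1) cadjoint_cadjoint)
qed

text \<open>
  The normalizer condition is about \<open>T\<^sup>* X T\<close>. To separate \<open>S\<close> and \<open>T\<close> it is applied to \<open>S + c T\<close>; by
  reflexivity it is enough to polarize the scalars \<open>\<langle>X R v | R y\<rangle>\<close> with \<open>y\<close> orthogonal to an invariant
  subspace containing \<open>v\<close>.
\<close>

lemma normalizer_polarization:
  assumes A: "reflexive_algebra \<A>" and B: "reflexive_algebra \<B>" and U: "ternary_space \<U>"
    and N: "\<U> \<subseteq> normalizer \<B> \<A>" and S: "S \<in> \<U>" and T: "T \<in> \<U>" and X: "X \<in> \<B>"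
  shows "cadjoint T \<circ> X \<circ> S \<in> \<A>"
proof (rule reflexive_algebraI[OF A])
  note UD = ternary_spaceD[OF U]
  note bo = UD(1)[OF S] UD(1)[OF T] and XB = reflexive_algebra_bounded[OF B X]
  show "cadjoint T \<circ> X \<circ> S \<in> bounded_ops UNIV UNIV"
    by (intro bounded_ops_comp cadjoint(1) bo XB)
  fix V v assume V: "V \<in> inv_subspaces UNIV \<A>" and v: "v \<in> V"
  have "cadjoint T (X (S v)) \<in> V"
  proof (rule closed_subspace_mem_orthogonal[OF inv_subspacesD(1)[OF V]])
    fix y assume y: "\<And>v. v \<in> V \<Longrightarrow> \<langle>v | y\<rangle> = 0"
    have diag: "\<langle>X (R v) | R y\<rangle> = 0" if R: "R \<in> \<U>" for R
    proof -
      have "cadjoint R \<circ> X \<circ> R \<in> \<A>"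
        using N R X unfolding normalizer_def by blast
      then have "(cadjoint R \<circ> X \<circ> R) v \<in> V"
        by (rule inv_subspacesD(3)[OF V _ v])
      then show ?thesis
        using y by (simp add: cadjoint(3)[OF UD(1)[OF R], symmetric])
    qed
    have "c * \<langle>X (T v) | S y\<rangle> + cnj c * \<langle>X (S v) | T y\<rangle> = 0" for c
      using diag[OF UD(2)[OF S UD(3)[OF T, of c]]] diag[OF S] diag[OF T]
      by (simp add: bounded_opsD[OF XB] cinner_add_left cinner_add_right cinner_scaleC_left cinner_scaleC_right)
    \<comment> \<open>\<open>c = 1\<close> and \<open>c = \<i>\<close> determine the sum and the difference of the two mixed terms\<close>
    from this[of 1] this[of \<i>] have "\<langle>X (S v) | T y\<rangle> = 0"
      by (simp add: complex_eq_iff)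
    then show "\<langle>cadjoint T (X (S v)) | y\<rangle> = 0"
      by (simp add: cadjoint(3)[OF bo(2)])
  qed
  then show "(cadjoint T \<circ> X \<circ> S) v \<in> V" by simp
qed

text \<open>
  By nondegeneracy the \<open>K2\<close>-component of \<open>X w\<close> is in \<open>[\<U> V]\<close> once all \<open>S T\<^sup>* X w\<close> are. For \<open>w = R v\<close> the
  vector \<open>T\<^sup>* X R v\<close> lies in \<open>V\<close>, as \<open>T\<^sup>* X R\<close> is in \<open>\<A>\<close> and has its range in \<open>K1\<close>.
\<close>

lemma image_span_inv_subspace:
  fixes \<U> :: "('a::separable_chilbert \<Rightarrow> 'b::separable_chilbert) set"
  assumes U: "ternary_space \<U>" and B: "reflexive_algebra \<B>"
    and K1: "K1 = image_span (adjoints \<U>) UNIV" and K2: "K2 = image_span \<U> UNIV"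
    and N: "\<And>S T X. S \<in> \<U> \<Longrightarrow> T \<in> \<U> \<Longrightarrow> X \<in> \<B> \<Longrightarrow> cadjoint T \<circ> X \<circ> S \<in> \<A>"
    and V: "V \<in> inv_subspaces K1 (compression K1 \<A>)"
  shows "image_span \<U> V \<in> inv_subspaces K2 (compression K2 \<B>)"
proof -
  note bo = ternary_spaceD(1)[OF U]
  have K1C: "closed_subspace K1" by (simp add: K1)
  have "proj_onto UNIV K2 (X w) \<in> image_span \<U> V"
    if X: "X \<in> \<B>" and w: "w \<in> image_span \<U> V" for X w
    unfolding K2
  proof (rule nondegenerate[OF U closed_subspace_image_span])
    fix S T assume S: "S \<in> \<U>" and T: "T \<in> \<U>"
    have "image_span \<U> V \<subseteq> {w. (S \<circ> (cadjoint T \<circ> X)) w \<in> image_span \<U> V}"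
    proof (intro image_span_minimal closed_subspace_vimage bounded_ops_comp cadjoint(1) bo S T
        reflexive_algebra_bounded[OF B X] closed_subspace_image_span)
      fix R v assume R: "R \<in> \<U>" and v: "v \<in> V"
      have "proj_onto UNIV K1 ((cadjoint T \<circ> X \<circ> R) v) \<in> V"
        using V N[OF R T X] v unfolding inv_subspaces_compression by blast
      moreover have "cadjoint T (X (R v)) \<in> K1"
        unfolding K1 using T by (intro image_span_mem) (simp_all add: adjoints_def)
      ultimately have "cadjoint T (X (R v)) \<in> V"
        by (simp add: proj_onto_UNIV(3)[OF K1C])
      then show "R v \<in> {w. (S \<circ> (cadjoint T \<circ> X)) w \<in> image_span \<U> V}"
        using S by (simp add: image_span_mem)
    qed
    then show "S (cadjoint T (X w)) \<in> image_span \<U> V" using w by auto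
  qed
  then show ?thesis
    unfolding inv_subspaces_compression K2 by (simp add: image_span_mono)
qed

text \<open>
  This provides preimages under \<open>V \<mapsto> [\<U> V]\<close>: one inclusion is invariance under \<open>\<U>\<U>\<^sup>* \<subseteq> \<B>\<close>, the other
  is nondegeneracy.
\<close>

lemma image_span_adjoints_inverse:
  fixes \<U> :: "('a::separable_chilbert \<Rightarrow> 'b::separable_chilbert) set"
  assumes U: "ternary_space \<U>" and K2: "K2 = image_span \<U> UNIV"
    and UU: "\<And>S T. S \<in> \<U> \<Longrightarrow> T \<in> \<U> \<Longrightarrow> S \<circ> cadjoint T \<in> \<B>"
    and V: "V \<in> inv_subspaces K2 (compression K2 \<B>)"
  shows "image_span \<U> (image_span (adjoints \<U>) V) = V"
proof
  note bo = ternary_spaceD(1)[OF U]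
  have K2C: "closed_subspace K2" by (simp add: K2)
  have VC: "closed_subspace V" and VK: "V \<subseteq> K2" by (rule inv_subspacesD[OF V])+
  show "image_span \<U> (image_span (adjoints \<U>) V) \<subseteq> V"
  proof (rule image_span_minimal[OF VC])
    fix S x assume S: "S \<in> \<U>" and x: "x \<in> image_span (adjoints \<U>) V"
    have "image_span (adjoints \<U>) V \<subseteq> {x. S x \<in> V}"
    proof (intro image_span_minimal closed_subspace_vimage bo S VC)
      fix R v assume "R \<in> adjoints \<U>" and v: "v \<in> V"
      then obtain T where T: "T \<in> \<U>" and R: "R = cadjoint T" unfolding adjoints_def by blast
      have "proj_onto UNIV K2 ((S \<circ> cadjoint T) v) \<in> V"
        using V UU[OF S T] v unfolding inv_subspaces_compression by blast
      moreover have "S (cadjoint T v) \<in> K2"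
        unfolding K2 using S by (simp add: image_span_mem)
      ultimately show "R v \<in> {x. S x \<in> V}"
        by (simp add: R proj_onto_UNIV(3)[OF K2C])
    qed
    then show "S x \<in> V" using x by blast
  qed
  show "V \<subseteq> image_span \<U> (image_span (adjoints \<U>) V)"
  proof
    fix v assume v: "v \<in> V"
    have "proj_onto UNIV K2 v \<in> image_span \<U> (image_span (adjoints \<U>) V)"
      unfolding K2 using v
      by (intro nondegenerate[OF U] closed_subspace_image_span image_span_mem)
        (simp_all add: adjoints_def)
    then show "v \<in> image_span \<U> (image_span (adjoints \<U>) V)"
      using proj_onto_UNIV(3)[OF K2C] v VK by auto
  qed
qed

text \<open>
  An \<open>\<A>\<close>-invariant subspace is invariant under \<open>\<U>\<^sup>*\<U>\<close>, so by nondegeneracy it is mapped into itself by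
  the projection onto \<open>K1\<close>.
\<close>

lemma inv_subspace_compression_Int:
  assumes U: "ternary_space \<U>" and K1: "K1 = image_span (adjoints \<U>) UNIV"
    and UU: "\<And>S T. S \<in> \<U> \<Longrightarrow> T \<in> \<U> \<Longrightarrow> cadjoint T \<circ> S \<in> \<A>"
    and V: "V \<in> inv_subspaces UNIV \<A>"
  shows "v \<in> V \<Longrightarrow> proj_onto UNIV K1 v \<in> V \<inter> K1"
    and "V \<inter> K1 \<in> inv_subspaces K1 (compression K1 \<A>)"
proof -
  have K1C: "closed_subspace K1" by (simp add: K1)
  show *: "proj_onto UNIV K1 v \<in> V \<inter> K1" if "v \<in> V" for v
  proof
    show "proj_onto UNIV K1 v \<in> V"
      unfolding K1
    proof (rule nondegenerate_adjoints[OF U inv_subspacesD(1)[OF V]])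
      fix S T assume "S \<in> \<U>" "T \<in> \<U>"
      then show "cadjoint S (T v) \<in> V"
        using inv_subspacesD(3)[OF V UU that] by (metis comp_apply)
    qed
  qed (rule proj_onto_UNIV(1)[OF K1C])
  show "V \<inter> K1 \<in> inv_subspaces K1 (compression K1 \<A>)"
    unfolding inv_subspaces_compression
    using closed_subspace_Int[OF inv_subspacesD(1)[OF V] K1C] * inv_subspacesD(3)[OF V] by blast
qed

text \<open>
  By reflexivity it suffices that \<open>T\<^sup>* X T\<close> and \<open>T X T\<^sup>*\<close> preserve invariant subspaces. Both are followed
  through the subspaces matched by \<open>V \<mapsto> [\<U> V]\<close>. The projections onto \<open>K1\<close> and \<open>K2\<close> that compression
  introduces are absorbed by \<open>T\<close> and \<open>T\<^sup>*\<close>.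
\<close>

lemma normalizer_if_image_span:
  fixes \<U> :: "('a::separable_chilbert \<Rightarrow> 'b::separable_chilbert) set"
  assumes A: "reflexive_algebra \<A>" and B: "reflexive_algebra \<B>" and U: "ternary_space \<U>"
    and K1: "K1 = image_span (adjoints \<U>) UNIV" and K2: "K2 = image_span \<U> UNIV"
    and UA: "\<And>S T. S \<in> \<U> \<Longrightarrow> T \<in> \<U> \<Longrightarrow> cadjoint T \<circ> S \<in> \<A>"
    and UB: "\<And>S T. S \<in> \<U> \<Longrightarrow> T \<in> \<U> \<Longrightarrow> S \<circ> cadjoint T \<in> \<B>"
    and onto: "image_span \<U> ` inv_subspaces K1 (compression K1 \<A>) = inv_subspaces K2 (compression K2 \<B>)"
  shows "\<U> \<subseteq> normalizer \<B> \<A>"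
proof
  fix T assume T: "T \<in> \<U>"
  note bo = ternary_spaceD(1)[OF U]
  have K1C: "closed_subspace K1" by (simp add: K1)
  have TK: "cadjoint T w \<in> K1" for w
    unfolding K1 using T by (intro image_span_mem) (simp_all add: adjoints_def)
  have "cadjoint T \<circ> X \<circ> T \<in> \<A>" if X: "X \<in> \<B>" for X
  proof (rule reflexive_algebraI[OF A])
    show "cadjoint T \<circ> X \<circ> T \<in> bounded_ops UNIV UNIV"
      by (intro bounded_ops_comp cadjoint(1) bo T reflexive_algebra_bounded[OF B X])
    fix V v assume V: "V \<in> inv_subspaces UNIV \<A>" and v: "v \<in> V"
    note VC = inv_subspacesD(1)[OF V]
    have Int: "proj_onto UNIV K1 v \<in> V \<inter> K1" "V \<inter> K1 \<in> inv_subspaces K1 (compression K1 \<A>)"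
      by (rule inv_subspace_compression_Int[OF U K1 _ V]; fact UA v)+
    define W where "W = image_span \<U> (V \<inter> K1)"
    have W: "W \<in> inv_subspaces K2 (compression K2 \<B>)"
      unfolding W_def using Int(2) onto by blast
    have "T (proj_onto UNIV K1 v) \<in> W"
      unfolding W_def by (intro image_span_mem T Int(1))
    then have "T v \<in> W"
      using operator_projection[OF U T] by (simp add: K1)
    then have "proj_onto UNIV K2 (X (T v)) \<in> W"
      using W X unfolding inv_subspaces_compression by blast
    moreover have "W \<subseteq> {w. cadjoint T w \<in> V}"
      unfolding W_def
    proof (intro image_span_minimal closed_subspace_vimage cadjoint(1) bo T VC)
      fix S x assume "S \<in> \<U>" "x \<in> V \<inter> K1"
      then show "S x \<in> {w. cadjoint T w \<in> V}"
        using inv_subspacesD(3)[OF V UA[OF _ T], of S x] by simp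
    qed
    ultimately have "cadjoint T (proj_onto UNIV K2 (X (T v))) \<in> V" by blast
    then show "(cadjoint T \<circ> X \<circ> T) v \<in> V"
      using adjoint_projection[OF T bo[OF T]] by (simp add: K2)
  qed
  moreover have "T \<circ> X \<circ> cadjoint T \<in> \<B>" if X: "X \<in> \<A>" for X
  proof (rule reflexive_algebraI[OF B])
    show "T \<circ> X \<circ> cadjoint T \<in> bounded_ops UNIV UNIV"
      by (intro bounded_ops_comp cadjoint(1) bo T reflexive_algebra_bounded[OF A X])
    fix V v assume V: "V \<in> inv_subspaces UNIV \<B>" and v: "v \<in> V"
    have aa: "adjoints (adjoints \<U>) = \<U>" using bo by (intro adjoints_adjoints) blast
    have dual: "cadjoint R \<circ> S \<in> \<B>" if "S \<in> adjoints \<U>" "R \<in> adjoints \<U>" for R S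
      using that UB cadjoint_cadjoint[OF bo] unfolding adjoints_def by auto
    have K2': "K2 = image_span (adjoints (adjoints \<U>)) UNIV" by (simp add: K2 aa)
    have Int: "proj_onto UNIV K2 v \<in> V \<inter> K2" "V \<inter> K2 \<in> inv_subspaces K2 (compression K2 \<B>)"
      by (rule inv_subspace_compression_Int[OF ternary_space_adjoints[OF U] K2' _ V]; fact dual v)+
    obtain V1 where V1: "V1 \<in> inv_subspaces K1 (compression K1 \<A>)" and img: "V \<inter> K2 = image_span \<U> V1"
      using Int(2) onto by blast
    have V1C: "closed_subspace V1" by (rule inv_subspacesD(1)[OF V1])
    have V1_inv: "proj_onto UNIV K1 (Y x) \<in> V1" if "Y \<in> \<A>" "x \<in> V1" for Y x
      using V1 that unfolding inv_subspaces_compression by blast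
    have "V \<inter> K2 \<subseteq> {w. cadjoint T w \<in> V1}"
      unfolding img
    proof (intro image_span_minimal closed_subspace_vimage cadjoint(1) bo T V1C)
      fix S x assume "S \<in> \<U>" "x \<in> V1"
      then have "proj_onto UNIV K1 (cadjoint T (S x)) \<in> V1"
        using V1_inv[OF UA[OF _ T]] by (metis comp_apply)
      then show "S x \<in> {w. cadjoint T w \<in> V1}"
        using proj_onto_UNIV(3)[OF K1C TK] by simp
    qed
    then have "cadjoint T (proj_onto UNIV K2 v) \<in> V1"
      using Int(1) by blast
    then have "cadjoint T v \<in> V1"
      using adjoint_projection[OF T bo[OF T]] by (simp add: K2)
    then have "T (proj_onto UNIV K1 (X (cadjoint T v))) \<in> image_span \<U> V1"
      by (intro image_span_mem T V1_inv X)
    then have "T (X (cadjoint T v)) \<in> V \<inter> K2"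
      using operator_projection[OF U T] by (simp add: img K1)
    then show "(T \<circ> X \<circ> cadjoint T) v \<in> V" by simp
  qed
  ultimately show "T \<in> normalizer \<B> \<A>"
    using bo[OF T] unfolding normalizer_def by blast
qed

lemma Map_restriction:
  assumes K: "closed_subspace K" and V: "closed_subspace V" "V \<subseteq> K"
  shows "Map K K2 (restriction K \<U>) (proj_onto K V) = proj_onto K2 (image_span \<U> V)"
proof -
  have "{S x | S x. S \<in> restriction K \<U> \<and> x \<in> V} = (\<Union>S\<in>\<U>. restrict S K ` V)"
    unfolding restriction_def by blast
  also have "\<dots> = (\<Union>S\<in>\<U>. S ` V)"
    using V(2) by (intro SUP_cong image_cong) auto
  also have "\<dots> = {S x | S x. S \<in> \<U> \<and> x \<in> V}" by blast
  finally have "{S x | S x. S \<in> restriction K \<U> \<and> x \<in> V} = {S x | S x. S \<in> \<U> \<and> x \<in> V}" .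
  then show ?thesis
    by (simp add: Map_eq_image_span image_span_def proj_onto(2)[OF K V])
qed

lemma Map_restriction_Lat_iff:
  fixes \<U> :: "('a::separable_chilbert \<Rightarrow> 'b::separable_chilbert) set"
  assumes K1: "closed_subspace K1" and K2: "K2 = image_span \<U> UNIV"
  shows "Map K1 K2 (restriction K1 \<U>) ` Lat K1 (compression K1 \<A>) = Lat K2 (compression K2 \<B>)
    \<longleftrightarrow> image_span \<U> ` inv_subspaces K1 (compression K1 \<A>) = inv_subspaces K2 (compression K2 \<B>)"
proof -
  let ?I1 = "inv_subspaces K1 (compression K1 \<A>)" and ?I2 = "inv_subspaces K2 (compression K2 \<B>)"
  have K2C: "closed_subspace K2" by (simp add: K2)
  have "Map K1 K2 (restriction K1 \<U>) ` Lat K1 (compression K1 \<A>) = proj_onto K2 ` image_span \<U> ` ?I1"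
    unfolding Lat_compression[OF K1] image_image
    by (intro image_cong refl Map_restriction[OF K1] inv_subspacesD)
  moreover have "image_span \<U> ` ?I1 \<subseteq> {V. closed_subspace V \<and> V \<subseteq> K2}"
    by (auto simp: K2 dest: subsetD[OF image_span_mono[OF subset_UNIV]])
  moreover have "?I2 \<subseteq> {V. closed_subspace V \<and> V \<subseteq> K2}"
    by (auto simp: inv_subspaces_def)
  ultimately show ?thesis
    unfolding Lat_compression[OF K2C]
    using inj_on_image_eq_iff[OF inj_on_proj_onto[OF K2C]] by simp
qed

theorem corollary5p8:
  fixes \<A> :: "('a::separable_chilbert \<Rightarrow> 'a) set"
    and \<B> :: "('b::separable_chilbert \<Rightarrow> 'b) set"
    and \<U> :: "('a \<Rightarrow> 'b) set"
    and chi :: "('a \<Rightarrow> 'a) \<Rightarrow> 'b \<Rightarrow> 'b"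
    and chi_star :: "('b \<Rightarrow> 'b) \<Rightarrow> 'a \<Rightarrow> 'a"
    and K1 :: "'a set" and K2 :: "'b set"
    and \<A>o :: "('a \<Rightarrow> 'a) set" and \<B>o :: "('b \<Rightarrow> 'b) set" and \<U>o :: "('a \<Rightarrow> 'b) set"
    and chi_o :: "('a \<Rightarrow> 'a) \<Rightarrow> 'b \<Rightarrow> 'b"
  assumes "reflexive_algebra \<A>" and "reflexive_algebra \<B>"
    and "operator_subspace \<U>" and "normalizing \<U>" and "closedin ultraweak_topology \<U>"
    and "chi = Map UNIV UNIV \<U>" and "chi_star = Map UNIV UNIV (adjoints \<U>)"
    and "K1 = closed_span {S y | S y. S \<in> adjoints \<U>}"
    and "K2 = closed_span {S x | S x. S \<in> \<U>}"
    and "\<A>o = compression K1 \<A>" and "\<B>o = compression K2 \<B>"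
    and "\<U>o = restriction K1 \<U>" and "chi_o = Map K1 K2 \<U>o"
  shows "\<U> \<subseteq> normalizer \<B> \<A> \<longleftrightarrow>
    ((\<forall>L\<in>Lat UNIV \<A>. proj_orthogonal UNIV (chi L) (chi (proj_compl UNIV L))) \<and>
     (\<forall>M\<in>Lat UNIV \<B>. proj_orthogonal UNIV (chi_star M) (chi_star (proj_compl UNIV M)))) \<and>
    chi_o ` Lat K1 \<A>o = Lat K2 \<B>o"
proof -
  note A = assms(1) and B = assms(2)
  have U: "ternary_space \<U>" using assms(3,4) by (simp add: ternary_space_def)
  have U': "ternary_space (adjoints \<U>)" by (rule ternary_space_adjoints[OF U])
  note bo = ternary_spaceD(1)[OF U]
  have aa: "adjoints (adjoints \<U>) = \<U>" using bo by (intro adjoints_adjoints) blast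
  have K1: "K1 = image_span (adjoints \<U>) UNIV" and K2: "K2 = image_span \<U> UNIV"
    by (simp_all add: assms(8,9) image_span_def)
  have K1C: "closed_subspace K1" by (simp add: K1)
  have one: "id \<in> \<A>" "id \<in> \<B>"
    using A B unfolding reflexive_algebra_def unital_algebra_def by blast+
  let ?UA = "\<forall>S\<in>\<U>. \<forall>T\<in>\<U>. cadjoint T \<circ> S \<in> \<A>" and ?UB = "\<forall>S\<in>\<U>. \<forall>T\<in>\<U>. S \<circ> cadjoint T \<in> \<B>"
  let ?I1 = "inv_subspaces K1 \<A>o" and ?I2 = "inv_subspaces K2 \<B>o"
  have i1: "(\<forall>L\<in>Lat UNIV \<A>. proj_orthogonal UNIV (chi L) (chi (proj_compl UNIV L))) \<longleftrightarrow> ?UA"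
    unfolding assms(6) by (rule orthogonal_images_iff[OF A U])
  have "(\<forall>S\<in>adjoints \<U>. \<forall>T\<in>adjoints \<U>. cadjoint T \<circ> S \<in> \<B>) \<longleftrightarrow> ?UB"
    unfolding adjoints_def by (auto simp: cadjoint_cadjoint bo)
  then have i2: "(\<forall>M\<in>Lat UNIV \<B>. proj_orthogonal UNIV (chi_star M) (chi_star (proj_compl UNIV M))) \<longleftrightarrow> ?UB"
    unfolding assms(7) using orthogonal_images_iff[OF B U'] by blast
  have ii: "chi_o ` Lat K1 \<A>o = Lat K2 \<B>o \<longleftrightarrow> image_span \<U> ` ?I1 = ?I2"
    unfolding assms(10-13) by (rule Map_restriction_Lat_iff[OF K1C K2])
  have "\<U> \<subseteq> normalizer \<B> \<A> \<longleftrightarrow> (?UA \<and> ?UB) \<and> image_span \<U> ` ?I1 = ?I2"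
  proof
    assume N: "\<U> \<subseteq> normalizer \<B> \<A>"
    note N' = normalizer_adjoints[OF U N]
    note polA = normalizer_polarization[OF A B U N]
    note polB = normalizer_polarization[OF B A U' N']
    have ?UA
      using polA[OF _ _ one(2)] by simp
    have UB: "S \<circ> cadjoint T \<in> \<B>" if "S \<in> \<U>" "T \<in> \<U>" for S T
      using polB[OF _ _ one(1), of "cadjoint T" "cadjoint S"] that cadjoint_cadjoint[OF bo]
      by (simp add: adjoints_def)
    have "image_span \<U> ` ?I1 = ?I2"
    proof (intro equalityI subsetI)
      fix W assume "W \<in> image_span \<U> ` ?I1"
      then show "W \<in> ?I2"
        using image_span_inv_subspace[OF U B K1 K2 polA] unfolding assms(10,11) by blast
    next
      fix W assume W: "W \<in> ?I2"
      have "image_span (adjoints \<U>) W \<in> ?I1"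
        unfolding assms(10)
        by (rule image_span_inv_subspace[OF U' A _ K1 polB W[unfolded assms(11)]])
          (simp_all add: K2 aa)
      moreover have "image_span \<U> (image_span (adjoints \<U>) W) = W"
        by (rule image_span_adjoints_inverse[OF U K2 UB W[unfolded assms(11)]])
      ultimately show "W \<in> image_span \<U> ` ?I1" by (metis imageI)
    qed
    then show "(?UA \<and> ?UB) \<and> image_span \<U> ` ?I1 = ?I2"
      using \<open>?UA\<close> UB by blast
  next
    assume *: "(?UA \<and> ?UB) \<and> image_span \<U> ` ?I1 = ?I2"
    show "\<U> \<subseteq> normalizer \<B> \<A>"
      by (rule normalizer_if_image_span[OF A B U K1 K2]) (use * assms(10,11) in blast)+
  qed
  then show ?thesis by (simp only: i1 i2 ii)
qed

end
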